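(* Let $F$ be a field of characteristic zero, $m$ a positive integer, and let $A$ be a grading by a group $G$ on $UT_m(F)$. If $A$ admits a graded involution $\circ$, then there exists a group homomorphism $\alpha:\mathbb{Z}^{\lfloor m/2\rfloor}\to G$ such that $(A,\circ)$ is isomorphic, as a $G$-graded algebra with involution, to $UT_m(F)$ with the $G$-grading induced by $\alpha$ from the finest grading on $UT_m(F)$ and with the reflection involution or the symplectic involution (the latter being defined only for $m$ even).
   Context: $UT_m(F)$ is the algebra of $m\times m$ upper triangular matrices over $F$, with elementary matrices $E_{i,j}$, $i\le j$. A $G$-grading on an algebra $A$ is a vector space decomposition $A=\oplus_{g\in G}A_g$ with $A_gA_h\subseteq A_{gh}$. An involution is a linear map $\circ$ with $(a^\circ)^\circ=a$, $(ab)^\circ=b^\circ a^\circ$; it is graded if $A_g^\circ\subseteq A_g$ for all $g$. An isomorphism of graded algebras with involution is an algebra isomorphism mapping the component of degree $g$ into the component of degree $g$ for every $g$ and intertwining the involutions. The elementary grading on $UT_m(F)$ induced by $(g_1,\dots,g_m)\in G^m$ is the one in which $E_{i,j}$ is homogeneous of degree $g_ig_j^{-1}$ ($g_i-g_j$ in additive notation). The finest grading on $UT_m(F)$ is the elementary $\mathbb{Z}^{\lfloor m/2\rfloor}$-grading induced by $(e_1,\dots,e_r,0,e_r-e_{r-1},\dots,e_r-e_1)$ if $m=2r$, and by $(e_1,\dots,e_r,0,-e_r,\dots,-e_1)$ if $m=2r+1$, where $e_i$ is the tuple with $i$-th entry $1$ and the other entries $0$. Given a grading $A=\oplus_{k\in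 K}A_k$ by a group $K$ and a homomorphism $\alpha:K\to G$, the $G$-grading induced by $\alpha$ has components $A'_g=\oplus_{k\in\alpha^{-1}(g)}A_k$. The reflection involution $\ast$ on $UT_m(F)$ is the linear map with $E_{i,j}^\ast=E_{m+1-j,m+1-i}$. For $m=2r$ the symplectic involution is $a^s=Da^\ast D^{-1}$ with $D=\mathrm{diag}(I_r,-I_r)$. *)

theory Defs
  imports "Jordan_Normal_Form.VS_Connect" "HOL-Algebra.Product_Groups" "HOL-Algebra.QuotRing"
begin

section \<open>Graded algebras with involution\<close>

text \<open>An algebra over the field \<^typ>\<open>'a\<close> is represented by a \<open>module\<close> record, which carries a
  multiplication, a unit and a scalar multiplication.  The group of degrees is an arbitrary,
  not necessarily commutative, group.  A family of components \<open>A\<close> is only relevant on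
  \<open>carrier G\<close>.\<close>

definition is_grading ::
  "('g, 'c) monoid_scheme \<Rightarrow> ('a :: field, 'v, 'd) module_scheme \<Rightarrow> ('g \<Rightarrow> 'v set) \<Rightarrow> bool" where
  "is_grading G B A \<longleftrightarrow>
     (\<forall>g\<in>carrier G. subspace class_ring (A g) B) \<and>
     (\<forall>x\<in>carrier B. \<exists>!f. f \<in> (\<Pi>\<^sub>E g\<in>carrier G. A g) \<and>
        finite {g \<in> carrier G. f g \<noteq> \<zero>\<^bsub>B\<^esub>} \<and>
        x = (\<Oplus>\<^bsub>B\<^esub>g\<in>{g \<in> carrier G. f g \<noteq> \<zero>\<^bsub>B\<^esub>}. f g)) \<and>
     (\<forall>g\<in>carrier G. \<forall>h\<in>carrier G. \<forall>x\<in>A g. \<forall>y\<in>A h. x \<otimes>\<^bsub>B\<^esub> y \<in> A (g \<otimes>\<^bsub>G\<^esub> h))"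

definition is_involution :: "('a :: field, 'v, 'd) module_scheme \<Rightarrow> ('v \<Rightarrow> 'v) \<Rightarrow> bool" where
  "is_involution B s \<longleftrightarrow>
     linear_map class_ring B B s \<and>
     (\<forall>a\<in>carrier B. s (s a) = a) \<and>
     (\<forall>a\<in>carrier B. \<forall>b\<in>carrier B. s (a \<otimes>\<^bsub>B\<^esub> b) = s b \<otimes>\<^bsub>B\<^esub> s a)"

definition is_graded_involution ::
  "('g, 'c) monoid_scheme \<Rightarrow> ('a :: field, 'v, 'd) module_scheme \<Rightarrow> ('g \<Rightarrow> 'v set) \<Rightarrow>
     ('v \<Rightarrow> 'v) \<Rightarrow> bool" where
  "is_graded_involution G B A s \<longleftrightarrow>
     is_involution B s \<and> (\<forall>g\<in>carrier G. s ` A g \<subseteq> A g)"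

definition graded_inv_isomorphic ::
  "('g, 'c) monoid_scheme \<Rightarrow>
     ('a :: field, 'v, 'd) module_scheme \<Rightarrow> ('g \<Rightarrow> 'v set) \<Rightarrow> ('v \<Rightarrow> 'v) \<Rightarrow>
     ('a, 'w, 'e) module_scheme \<Rightarrow> ('g \<Rightarrow> 'w set) \<Rightarrow> ('w \<Rightarrow> 'w) \<Rightarrow> bool" where
  "graded_inv_isomorphic G B A s B' A' s' \<longleftrightarrow>
     (\<exists>\<phi>. linear_map class_ring B B' \<phi> \<and> \<phi> \<in> ring_iso B B' \<and>
        (\<forall>g\<in>carrier G. \<phi> ` A g \<subseteq> A' g) \<and>
        (\<forall>x\<in>carrier B. \<phi> (s x) = s' (\<phi> x)))"

text \<open>The component of degree \<open>g\<close> is the (internal) sum of the components with degree in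
  the fibre of \<open>\<alpha>\<close> over \<open>g\<close>.\<close>

definition induced_grading ::
  "('k, 'c) monoid_scheme \<Rightarrow> ('a :: field, 'v, 'd) module_scheme \<Rightarrow> ('k \<Rightarrow> 'g) \<Rightarrow>
     ('k \<Rightarrow> 'v set) \<Rightarrow> 'g \<Rightarrow> 'v set" where
  "induced_grading K B \<alpha> A g =
     {\<Oplus>\<^bsub>B\<^esub>k\<in>S. f k | f S. finite S \<and> S \<subseteq> {k \<in> carrier K. \<alpha> k = g} \<and> f \<in> (\<Pi> k\<in>S. A k)}"

section \<open>Upper triangular matrices\<close>

definition UT :: "'a :: field itself \<Rightarrow> nat \<Rightarrow> ('a, 'a mat) module" where
  "UT ty m = (module_mat ty m m)\<lparr>carrier := {X \<in> carrier_mat m m. upper_triangular X}\<rparr>"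

text \<open>Matrix indices start at \<open>0\<close> here, so that \<open>matrix_unit m i j\<close> is the matrix usually
  denoted by $E_{i+1,j+1}$.  Likewise, an $m$-tuple is a function \<open>t\<close> of which only the values
  \<open>t 0, \<dots>, t (m - 1)\<close> matter.\<close>

definition matrix_unit :: "nat \<Rightarrow> nat \<Rightarrow> nat \<Rightarrow> 'a :: field mat" where
  "matrix_unit m i j = mat m m (\<lambda>p. if p = (i, j) then 1 else 0)"

definition elementary_grading ::
  "'a :: field itself \<Rightarrow> ('g, 'c) monoid_scheme \<Rightarrow> nat \<Rightarrow> (nat \<Rightarrow> 'g) \<Rightarrow> 'g \<Rightarrow> 'a mat set" where
  "elementary_grading ty G m t g =
     LinearCombinations.module.span class_ring (UT ty m)
       {matrix_unit m i j | i j. i \<le> j \<and> j < m \<and> t i \<otimes>\<^bsub>G\<^esub> inv\<^bsub>G\<^esub> (t j) = g}"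

definition Z_pow :: "nat \<Rightarrow> (nat \<Rightarrow> int) monoid" where
  "Z_pow r = product_group {..<r} (\<lambda>_. integer_group)"

definition std_vec :: "nat \<Rightarrow> nat \<Rightarrow> nat \<Rightarrow> int" where
  "std_vec r i = (\<lambda>k\<in>{..<r}. if k = i then 1 else 0)"

text \<open>With \<open>r = m div 2\<close>, in the usual numbering and in additive notation, the tuple is
  $(e_1,\ldots,e_r,0,e_r-e_{r-1},\ldots,e_r-e_1)$ for even $m$ and
  $(e_1,\ldots,e_r,0,-e_r,\ldots,-e_1)$ for odd $m$; the \<open>i\<close>-th and the \<open>(m-1-i)\<close>-th entry
  (counted from \<open>0\<close>) involve the same $e_{i+1}$.\<close>

definition finest_tuple :: "nat \<Rightarrow> nat \<Rightarrow> nat \<Rightarrow> int" where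
  "finest_tuple m i =
     (let r = m div 2; e = std_vec r in
      if i < r then e i
      else if i = r then \<one>\<^bsub>Z_pow r\<^esub>
      else if even m then e (r - 1) \<otimes>\<^bsub>Z_pow r\<^esub> inv\<^bsub>Z_pow r\<^esub> (e (m - 1 - i))
      else inv\<^bsub>Z_pow r\<^esub> (e (m - 1 - i)))"

definition finest_grading :: "'a :: field itself \<Rightarrow> nat \<Rightarrow> (nat \<Rightarrow> int) \<Rightarrow> 'a mat set" where
  "finest_grading ty m = elementary_grading ty (Z_pow (m div 2)) m (finest_tuple m)"

definition reflection :: "nat \<Rightarrow> 'a :: field mat \<Rightarrow> 'a mat" where
  "reflection m X = mat m m (\<lambda>(i, j). X $$ (m - 1 - j, m - 1 - i))"

text \<open>Only meaningful for even \<open>m\<close>, where \<open>D\<close> has size \<open>m\<close>.\<close>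

definition symplectic :: "nat \<Rightarrow> 'a :: field mat \<Rightarrow> 'a mat" where
  "symplectic m X =
     (let r = m div 2; D = diag_block_mat [1\<^sub>m r, - 1\<^sub>m r]
      in D * reflection m X * inv\<^bsub>UT TYPE('a) m\<^esub> D)"

text \<open>The reflection is defined entrywise; this is its description on the basis.\<close>

lemma reflection_matrix_unit:
  assumes "i < m" "j < m"
  shows "reflection m (matrix_unit m i j) = matrix_unit m (m - 1 - j) (m - 1 - i)"
  using assms unfolding reflection_def matrix_unit_def by (intro eq_matI) auto

lemma vectorspace_UT: "vectorspace class_ring (UT TYPE('a :: field) m)"
proof -
  have inv: "\<exists>Y\<in>carrier (UT TYPE('a) m). Y \<oplus>\<^bsub>UT TYPE('a) m\<^esub> X = \<zero>\<^bsub>UT TYPE('a) m\<^esub>"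
    if "X \<in> carrier (UT TYPE('a) m)" for X :: "'a mat"
    using that
    by (intro bexI[of _ "- X"]) (auto simp: UT_def module_mat_simps upper_triangular_def)
  have "abelian_group (UT TYPE('a) m)"
  proof (rule abelian_groupI)
    fix X :: "'a mat" assume "X \<in> carrier (UT TYPE('a) m)"
    thus "\<exists>Y\<in>carrier (UT TYPE('a) m). Y \<oplus>\<^bsub>UT TYPE('a) m\<^esub> X = \<zero>\<^bsub>UT TYPE('a) m\<^esub>"
      by (rule inv)
  qed (auto simp: UT_def module_mat_simps upper_triangular_def
        assoc_add_mat[of _ m m] intro!: comm_add_mat[of _ m m])
  moreover have F: "field (class_ring :: 'a ring)"
    by (rule class_field.field_axioms)
  ultimately show ?thesis
    unfolding vectorspace_def
    by (intro conjI Module.moduleI fieldE(1)[OF F])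
      (auto simp: UT_def module_mat_simps upper_triangular_def
        add_smult_distrib_right_mat[of _ m m] add_smult_distrib_left_mat[of _ m m])
qed

end

theory Submission
  imports Defs
begin

text \<open>If \<open>x\<close>, \<open>y\<close> are homogeneous of degrees \<open>g\<close>, \<open>h\<close> and \<open>x * y\<close> is nonzero, its image under the
involution has both degree \<open>g h\<close> and degree \<open>h g\<close>. So commutators of homogeneous elements are homogeneous,
and the radical, which consists of commutators, is graded. The chain of ideals spanned by the
end segments of the first row is then graded as well; acting on its one-dimensional factors,
an element of degree other than \<open>1\<close> must have zero diagonal, and the involution is seen to reverse
the diagonal. Hence there is a skew element of degree \<open>1\<close> with distinct eigenvalues. After
diagonalizing it by a triangular matrix, the grading is elementary and the involution maps
each matrix unit to a multiple of the reflected one; a diagonal change of basis turns these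
multiples into the signs of one of the two standard involutions.\<close>

section \<open>Upper triangular matrices\<close>

text \<open>Characteristic zero enters in three ways: bracketing with the diagonal matrix of entries
  \<open>0, ..., m - 1\<close> is invertible on strictly triangular matrices, the integers used as
  eigenvalues stay distinct, and a nonzero scalar differs from its negative. Explicit integer
  eigenvalues and a rescaling without square roots make algebraic closure unnecessary. The ideals
  inside the first row are tractable because the radical \<open>J\<close> determines them: the whole
  row is the right annihilator of \<open>J\<close>, and each further ideal is the previous one times
  \<open>J\<close>. Skew-symmetrizing an element could destroy its eigenvalues; since the involution
  reverses the diagonal, a diagonal that changes sign under reversal is doubled instead. Skewness
  then makes the involution send the joint eigenspace for \<open>(i, j)\<close> to the one for
  \<open>(m - 1 - j, m - 1 - i)\<close>. A noncommutative \<open>G\<close> does not obstruct the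
  homomorphism, because the degrees that define it commute with each other.\<close>

lemma UT_simps [simp]:
  "mult (UT ty m) = (*)" "add (UT ty m) = (+)" "one (UT ty m) = 1\<^sub>m m"
  "zero (UT ty m) = 0\<^sub>m m m" "module.smult (UT ty m) = (\<cdot>\<^sub>m)"
  by (simp_all add: UT_def module_mat_simps)

lemma carrier_UT_iff:
  "X \<in> carrier (UT ty m) \<longleftrightarrow> X \<in> carrier_mat m m \<and> (\<forall>i<m. \<forall>j<i. X $$ (i, j) = 0)"
  by (auto simp: UT_def upper_triangular_def)

lemma carrier_UT_dim [simp]:
  "X \<in> carrier (UT ty m) \<Longrightarrow> dim_row X = m" "X \<in> carrier (UT ty m) \<Longrightarrow> dim_col X = m"
  by (auto simp: carrier_UT_iff)

lemma carrier_UT_mat: "X \<in> carrier (UT ty m) \<Longrightarrow> X \<in> carrier_mat m m"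
  by (simp add: carrier_UT_iff)

lemma carrier_UT_lower: "X \<in> carrier (UT ty m) \<Longrightarrow> j < i \<Longrightarrow> i < m \<Longrightarrow> X $$ (i, j) = 0"
  by (simp add: carrier_UT_iff)

lemma UT_eqI:
  assumes "X \<in> carrier (UT ty m)" "Y \<in> carrier (UT ty m)"
    and "\<And>i j. i \<le> j \<Longrightarrow> j < m \<Longrightarrow> X $$ (i, j) = Y $$ (i, j)"
  shows "X = Y"
proof (rule eq_matI)
  fix i j assume "i < dim_row Y" "j < dim_col Y"
  thus "X $$ (i, j) = Y $$ (i, j)"
    using assms by (cases "i \<le> j") (auto simp: carrier_UT_lower)
qed (use assms in auto)

lemma mult_entry:
  assumes "X \<in> carrier (UT ty m)" "Y \<in> carrier (UT ty m)" "i < m" "j < m"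
  shows "(X * Y) $$ (i, j) = (\<Sum>k<m. X $$ (i, k) * Y $$ (k, j))"
  using assms by (simp add: scalar_prod_def lessThan_atLeast0)

lemma mult_diag:
  assumes "X \<in> carrier (UT ty m)" "Y \<in> carrier (UT ty m)" "i < m"
  shows "(X * Y) $$ (i, i) = X $$ (i, i) * Y $$ (i, i)"
proof -
  have "(X * Y) $$ (i, i) = (\<Sum>k\<in>{i}. X $$ (i, k) * Y $$ (k, i))"
    unfolding mult_entry[OF assms(1,2,3,3)] using assms(3)
    by (intro sum.mono_neutral_right)
       (auto, metis assms(1,2) carrier_UT_lower linorder_neqE_nat)
  thus ?thesis by simp
qed

lemma UT_closed [simp]:
  assumes "X \<in> carrier (UT ty m)" "Y \<in> carrier (UT ty m)"
  shows "X + Y \<in> carrier (UT ty m)" "X - Y \<in> carrier (UT ty m)"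
    "c \<cdot>\<^sub>m X \<in> carrier (UT ty m)" "- X \<in> carrier (UT ty m)"
    "X * Y \<in> carrier (UT ty m)"
proof -
  show "X * Y \<in> carrier (UT ty m)"
    unfolding carrier_UT_iff
  proof (intro conjI allI impI)
    fix i j assume *: "i < m" "j < i"
    show "(X * Y) $$ (i, j) = 0"
      unfolding mult_entry[OF assms *(1) less_trans[OF *(2,1)]]
    proof (rule sum.neutral, rule ballI)
      fix k assume "k \<in> {..<m}"
      thus "X $$ (i, k) * Y $$ (k, j) = 0"
        using assms * by (cases "k < i") (auto simp: carrier_UT_lower)
    qed
  qed (use assms in \<open>auto simp: carrier_UT_iff\<close>)
qed (use assms in \<open>auto simp: carrier_UT_iff\<close>)

lemma UT_consts [simp]: "0\<^sub>m m m \<in> carrier (UT ty m)" "1\<^sub>m m \<in> carrier (UT ty m)"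
  by (auto simp: carrier_UT_iff)

lemma UT_assoc:
  assumes "X \<in> carrier (UT ty m)" "Y \<in> carrier (UT ty m)" "Z \<in> carrier (UT ty m)"
  shows "(X * Y) * Z = X * (Y * Z)"
  using assms by (meson assoc_mult_mat carrier_UT_mat)

lemma UT_distrib:
  assumes "X \<in> carrier (UT ty m)" "Y \<in> carrier (UT ty m)" "Z \<in> carrier (UT ty m)"
  shows "X * (Y + Z) = X * Y + X * Z" "(X + Y) * Z = X * Z + Y * Z"
    "X * (Y - Z) = X * Y - X * Z" "(X - Y) * Z = X * Z - Y * Z"
  using assms
  by (meson mult_add_distrib_mat add_mult_distrib_mat mult_minus_distrib_mat
      minus_mult_distrib_mat carrier_UT_mat)+

lemma UT_smult_mult:
  assumes "X \<in> carrier (UT ty m)" "Y \<in> carrier (UT ty m)"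
  shows "(c \<cdot>\<^sub>m X) * Y = c \<cdot>\<^sub>m (X * Y)" "X * (c \<cdot>\<^sub>m Y) = c \<cdot>\<^sub>m (X * Y)"
  using assms by (meson mult_smult_assoc_mat mult_smult_distrib carrier_UT_mat)+

lemma matrix_unit_entry [simp]:
  "a < m \<Longrightarrow> b < m \<Longrightarrow> matrix_unit m i j $$ (a, b) = (if a = i \<and> b = j then 1 else 0)"
  by (simp add: matrix_unit_def)

lemma matrix_unit_closed: "i \<le> j \<Longrightarrow> matrix_unit m i j \<in> carrier (UT ty m)"
  by (auto simp: carrier_UT_iff) (auto simp: matrix_unit_def)

lemma matrix_unit_mult_left:
  assumes "X \<in> carrier (UT ty m)" "i \<le> j" "j < m" "a < m" "b < m"
  shows "(matrix_unit m i j * X) $$ (a, b) = (if a = i then X $$ (j, b) else 0)"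
proof -
  have "(matrix_unit m i j * X) $$ (a, b)
      = (\<Sum>k<m. if k = j then (if a = i then X $$ (j, b) else 0) else 0)"
    unfolding mult_entry[OF matrix_unit_closed[OF assms(2)] assms(1,4,5)]
    using assms by (intro sum.cong) auto
  thus ?thesis using assms by simp
qed

lemma matrix_unit_mult_right:
  assumes "X \<in> carrier (UT ty m)" "i \<le> j" "j < m" "a < m" "b < m"
  shows "(X * matrix_unit m i j) $$ (a, b) = (if b = j then X $$ (a, i) else 0)"
proof -
  have "(X * matrix_unit m i j) $$ (a, b)
      = (\<Sum>k<m. if k = i then (if b = j then X $$ (a, i) else 0) else 0)"
    unfolding mult_entry[OF assms(1) matrix_unit_closed[OF assms(2)] assms(4,5)]
    using assms by (intro sum.cong) auto
  thus ?thesis using assms by simp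
qed

lemma matrix_unit_mult:
  assumes "i \<le> j" "j \<le> k" "k < m"
  shows "matrix_unit m i j * matrix_unit m j k = (matrix_unit m i k :: 'a :: field mat)"
  using assms
  by (intro UT_eqI[where ty="TYPE('a)" and m=m] UT_closed)
     (auto simp: matrix_unit_closed matrix_unit_mult_left[where ty="TYPE('a)"]
        simp del: index_mult_mat)

lemma diag_closed: "mat m m (\<lambda>(i, j). if i = j then d i else 0) \<in> carrier (UT ty m)"
  by (auto simp: carrier_UT_iff)

lemma diag_mult_left:
  assumes "X \<in> carrier (UT ty m)" "a < m" "b < m"
  shows "(mat m m (\<lambda>(i, j). if i = j then d i else 0) * X) $$ (a, b) = d a * X $$ (a, b)"
proof -
  have "(mat m m (\<lambda>(i, j). if i = j then d i else 0) * X) $$ (a, b)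
      = (\<Sum>k<m. if k = a then d a * X $$ (a, b) else 0)"
    unfolding mult_entry[OF diag_closed assms] using assms by (intro sum.cong) auto
  thus ?thesis using assms by simp
qed

lemma diag_mult_right:
  assumes "X \<in> carrier (UT ty m)" "a < m" "b < m"
  shows "(X * mat m m (\<lambda>(i, j). if i = j then d i else 0)) $$ (a, b) = X $$ (a, b) * d b"
proof -
  have "(X * mat m m (\<lambda>(i, j). if i = j then d i else 0)) $$ (a, b)
      = (\<Sum>k<m. if k = b then X $$ (a, b) * d b else 0)"
    unfolding mult_entry[OF assms(1) diag_closed assms(2,3)] using assms
    by (intro sum.cong) auto
  thus ?thesis using assms by simp
qed

text \<open>Left and right eigenvectors by back substitution. Constructing both makes it unnecessary to
  show that the inverse of a triangular matrix is triangular: \<open>W * U\<close> below commutes with \<open>D\<close> and is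
  unipotent, hence is the identity.\<close>

function right_eigen :: "('a :: field) mat \<Rightarrow> nat \<Rightarrow> nat \<Rightarrow> 'a" where
  "right_eigen a i j = (if i = j then 1 else if j < i then 0 else
     (\<Sum>k\<in>{i<..j}. a $$ (i, k) * right_eigen a k j) / (a $$ (j, j) - a $$ (i, i)))"
  by pat_completeness auto
termination by (relation "measure (\<lambda>(a, i, j). j - i)") auto

function left_eigen :: "('a :: field) mat \<Rightarrow> nat \<Rightarrow> nat \<Rightarrow> 'a" where
  "left_eigen a i j = (if i = j then 1 else if j < i then 0 else
     (\<Sum>k\<in>{i..<j}. left_eigen a i k * a $$ (k, j)) / (a $$ (i, i) - a $$ (j, j)))"
  by pat_completeness auto
termination by (relation "measure (\<lambda>(a, i, j). j - i)") auto

declare right_eigen.simps [simp del] left_eigen.simps [simp del]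

lemma eigen_diag: "right_eigen a i i = 1" "left_eigen a i i = 1"
  by (simp_all add: right_eigen.simps[of _ i i] left_eigen.simps[of _ i i])

lemma eigen_lower: "j < i \<Longrightarrow> right_eigen a i j = 0" "j < i \<Longrightarrow> left_eigen a i j = 0"
  by (simp_all add: right_eigen.simps[of _ i j] left_eigen.simps[of _ i j])

text \<open>A triangular matrix has its eigenvalues on the diagonal, so distinct diagonal entries
  suffice over any field: the denominators in the back substitution are exactly their
  differences.\<close>

lemma UT_diagonalizable:
  fixes a :: "'a :: field mat"
  assumes a: "a \<in> carrier (UT TYPE('a) m)"
    and d: "\<And>i j. i < m \<Longrightarrow> j < m \<Longrightarrow> a $$ (i, i) = a $$ (j, j) \<Longrightarrow> i = j"
  defines "D \<equiv> mat m m (\<lambda>(i, j). if i = j then a $$ (i, i) else 0)"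
  obtains U W where "U \<in> carrier (UT TYPE('a) m)" "W \<in> carrier (UT TYPE('a) m)"
    "W * U = 1\<^sub>m m" "U * W = 1\<^sub>m m" "W * a = D * W"
proof -
  let ?C = "carrier (UT TYPE('a) m)"
  define U where "U = mat m m (\<lambda>(i, j). right_eigen a i j)"
  define W where "W = mat m m (\<lambda>(i, j). left_eigen a i j)"
  have U: "U \<in> ?C" and W: "W \<in> ?C"
    by (auto simp: carrier_UT_iff U_def W_def eigen_lower)
  have D: "D \<in> ?C" unfolding D_def by (rule diag_closed)
  have aU: "a * U = U * D"
  proof (rule UT_eqI[OF UT_closed(5)[OF a U] UT_closed(5)[OF U D]])
    fix i j assume ij: "i \<le> j" "j < m"
    have "(a * U) $$ (i, j) = (\<Sum>k\<in>{i..j}. a $$ (i, k) * right_eigen a k j)"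
      unfolding mult_entry[OF a U le_less_trans[OF ij] ij(2)] using ij
      by (intro sum.mono_neutral_cong_right)
         (auto simp: U_def eigen_lower not_le carrier_UT_lower[OF a])
    also have "\<dots> = a $$ (i, i) * right_eigen a i j
        + (\<Sum>k\<in>{i<..j}. a $$ (i, k) * right_eigen a k j)"
      using ij by (simp add: sum.head)
    \<comment> \<open>The recursion is this identity solved for \<open>right_eigen a i j\<close>;
      for \<open>i = j\<close> the remaining sum is empty.\<close>
    also have "\<dots> = right_eigen a i j * a $$ (j, j)"
    proof (cases "i = j")
      case False
      hence "a $$ (j, j) - a $$ (i, i) \<noteq> 0" using d[of i j] ij by auto
      moreover have "right_eigen a i j = (\<Sum>k\<in>{i<..j}. a $$ (i, k) * right_eigen a k j)
          / (a $$ (j, j) - a $$ (i, i))"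
        using False ij by (subst right_eigen.simps) auto
      ultimately show ?thesis by (simp add: divide_simps) (simp add: algebra_simps)
    qed (simp add: eigen_diag)
    also have "\<dots> = (U * D) $$ (i, j)"
      unfolding D_def diag_mult_right[OF U le_less_trans[OF ij] ij(2)] using ij by (simp add: U_def)
    finally show "(a * U) $$ (i, j) = (U * D) $$ (i, j)" .
  qed
  have Wa: "W * a = D * W"
  proof (rule UT_eqI[OF UT_closed(5)[OF W a] UT_closed(5)[OF D W]])
    fix i j assume ij: "i \<le> j" "j < m"
    have "(W * a) $$ (i, j) = (\<Sum>k\<in>{i..j}. left_eigen a i k * a $$ (k, j))"
      unfolding mult_entry[OF W a le_less_trans[OF ij] ij(2)] using ij
      by (intro sum.mono_neutral_cong_right)
         (auto simp: W_def eigen_lower not_le carrier_UT_lower[OF a])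
    also have "{i..j} = insert j {i..<j}" using ij by auto
    also have "(\<Sum>k\<in>insert j {i..<j}. left_eigen a i k * a $$ (k, j)) = left_eigen a i j * a $$ (j, j)
        + (\<Sum>k\<in>{i..<j}. left_eigen a i k * a $$ (k, j))"
      by simp
    also have "\<dots> = a $$ (i, i) * left_eigen a i j"
    proof (cases "i = j")
      case False
      hence "a $$ (i, i) - a $$ (j, j) \<noteq> 0" using d[of i j] ij by auto
      moreover have "left_eigen a i j = (\<Sum>k\<in>{i..<j}. left_eigen a i k * a $$ (k, j))
          / (a $$ (i, i) - a $$ (j, j))"
        using False ij by (subst left_eigen.simps) auto
      ultimately show ?thesis by (simp add: divide_simps) (simp add: algebra_simps)
    qed (simp add: eigen_diag)
    also have "\<dots> = (D * W) $$ (i, j)"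
      unfolding D_def diag_mult_left[OF W le_less_trans[OF ij] ij(2)] using ij by (simp add: W_def)
    finally show "(W * a) $$ (i, j) = (D * W) $$ (i, j)" .
  qed
  have "(W * U) * D = D * (W * U)"
    using U W D a aU Wa by (metis UT_assoc)
  have WU: "W * U = 1\<^sub>m m"
  proof (rule UT_eqI[OF UT_closed(5)[OF W U] UT_consts(2)])
    fix i j assume ij: "i \<le> j" "j < m"
    have "(W * U) $$ (i, j) * a $$ (j, j) = a $$ (i, i) * (W * U) $$ (i, j)"
      using arg_cong[OF \<open>(W * U) * D = D * (W * U)\<close>, of "\<lambda>X. X $$ (i, j)"] ij
        diag_mult_left[OF UT_closed(5)[OF W U], of i j] diag_mult_right[OF UT_closed(5)[OF W U], of i j]
      unfolding D_def by simp
    hence "(W * U) $$ (i, j) = 0" if "i \<noteq> j"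
      using d[of i j] ij that by (auto simp: mult.commute)
    moreover have "(W * U) $$ (i, i) = 1"
      using ij mult_diag[OF W U, of i] by (simp add: U_def W_def eigen_diag)
    ultimately show "(W * U) $$ (i, j) = 1\<^sub>m m $$ (i, j)" using ij by auto
  qed
  have "U * W = 1\<^sub>m m"
    using mat_mult_left_right_inverse[OF carrier_UT_mat[OF W] carrier_UT_mat[OF U] WU] .
  thus ?thesis using that U W WU Wa by blast
qed

section \<open>Gradings with a graded involution\<close>

locale graded_UT = group G for G :: "('g, 'c) monoid_scheme" (structure) +
  fixes m :: nat and A :: "'g \<Rightarrow> 'a :: field_char_0 mat set" and s :: "'a mat \<Rightarrow> 'a mat"
  assumes grading: "is_grading G (UT TYPE('a) m) A"
    and graded_involution: "is_graded_involution G (UT TYPE('a) m) A s"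
begin

abbreviation C :: "'a mat set" where "C \<equiv> carrier (UT TYPE('a) m)"

sublocale UT: abelian_group "UT TYPE('a) m"
  using vectorspace_UT[of m, where 'a='a] by (simp add: vectorspace_def Module.module_def)

lemma C_dim [simp]: "x \<in> C \<Longrightarrow> dim_row x = m" "x \<in> C \<Longrightarrow> dim_col x = m"
  by (rule carrier_UT_dim; assumption)+

lemma A_submodule: "g \<in> carrier G \<Longrightarrow> submodule class_ring (A g) (UT TYPE('a) m)"
  using grading by (simp add: is_grading_def subspace_def)

lemma A_C: "g \<in> carrier G \<Longrightarrow> x \<in> A g \<Longrightarrow> x \<in> C"
  using submodule.subset[OF A_submodule] by blast

lemma A_zero: "g \<in> carrier G \<Longrightarrow> 0\<^sub>m m m \<in> A g"
  using submodule.zero_closed[OF A_submodule] by simp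

lemma A_add: "g \<in> carrier G \<Longrightarrow> x \<in> A g \<Longrightarrow> y \<in> A g \<Longrightarrow> x + y \<in> A g"
  using submodule.m_closed[OF A_submodule] by simp

lemma A_smult: "g \<in> carrier G \<Longrightarrow> x \<in> A g \<Longrightarrow> c \<cdot>\<^sub>m x \<in> A g"
  using submodule.smult_closed[OF A_submodule, of g c x] by (simp add: class_ring_simps)

lemma A_uminus: "g \<in> carrier G \<Longrightarrow> x \<in> A g \<Longrightarrow> - x \<in> A g"
proof -
  assume g: "g \<in> carrier G" "x \<in> A g"
  have "(-1) \<cdot>\<^sub>m x = - x" by (intro eq_matI) auto
  thus ?thesis using A_smult[OF g, of "-1"] by simp
qed

lemma A_diff:
  assumes "g \<in> carrier G" "x \<in> A g" "y \<in> A g"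
  shows "x - y \<in> A g"
proof -
  have "x - y = x + - y"
    using assms A_C by (intro eq_matI) (auto simp: A_C)
  thus ?thesis using A_add A_uminus assms by simp
qed

lemma A_mult:
  "g \<in> carrier G \<Longrightarrow> h \<in> carrier G \<Longrightarrow> x \<in> A g \<Longrightarrow> y \<in> A h \<Longrightarrow> x * y \<in> A (g \<otimes> h)"
  using grading by (simp add: is_grading_def)

lemma s_linear_map: "linear_map class_ring (UT TYPE('a) m) (UT TYPE('a) m) s"
  using graded_involution by (simp add: is_graded_involution_def is_involution_def)

lemma s_hom: "s \<in> LinearCombinations.module_hom class_ring (UT TYPE('a) m) (UT TYPE('a) m)"
  using s_linear_map by (simp add: linear_map_def mod_hom_def mod_hom_axioms_def)

lemma s_closed [simp]: "x \<in> C \<Longrightarrow> s x \<in> C"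
  using s_hom by (auto simp: LinearCombinations.module_hom_def)

lemma s_add: "x \<in> C \<Longrightarrow> y \<in> C \<Longrightarrow> s (x + y) = s x + s y"
  using s_hom by (auto simp: LinearCombinations.module_hom_def)

lemma s_smult: "x \<in> C \<Longrightarrow> s (c \<cdot>\<^sub>m x) = c \<cdot>\<^sub>m s x"
  using s_hom by (auto simp: LinearCombinations.module_hom_def class_ring_simps)

lemma s_diff:
  assumes "x \<in> C" "y \<in> C"
  shows "s (x - y) = s x - s y"
proof -
  have *: "u - v = u + (-1) \<cdot>\<^sub>m v" if "u \<in> C" "v \<in> C" for u v
    using that by (intro eq_matI) auto
  show ?thesis
    using assms by (simp add: * s_add s_smult)
qed

lemma s_s: "x \<in> C \<Longrightarrow> s (s x) = x"
  using graded_involution by (simp add: is_graded_involution_def is_involution_def)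

lemma s_mult: "x \<in> C \<Longrightarrow> y \<in> C \<Longrightarrow> s (x * y) = s y * s x"
  using graded_involution by (simp add: is_graded_involution_def is_involution_def)

lemma s_zero: "s (0\<^sub>m m m) = 0\<^sub>m m m"
proof -
  have "s (0 \<cdot>\<^sub>m 0\<^sub>m m m) = 0 \<cdot>\<^sub>m s (0\<^sub>m m m)" by (rule s_smult) simp
  also have "\<dots> = 0\<^sub>m m m" using s_closed[OF UT_consts(1)] by (intro eq_matI) (auto simp: carrier_UT_iff)
  also have "0 \<cdot>\<^sub>m 0\<^sub>m m m = (0\<^sub>m m m :: 'a mat)" by (intro eq_matI) auto
  finally show ?thesis .
qed

lemma s_eq_zero: "x \<in> C \<Longrightarrow> s x = 0\<^sub>m m m \<Longrightarrow> x = 0\<^sub>m m m"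
  using s_s[of x] s_zero by simp

lemma s_A: "g \<in> carrier G \<Longrightarrow> x \<in> A g \<Longrightarrow> s x \<in> A g"
  using graded_involution by (auto simp: is_graded_involution_def)

subsection \<open>Homogeneous components\<close>

text \<open>The predicate under the unique existence quantifier of \<open>is_grading\<close>,
  isolated so that \<open>THE\<close> can select the family. Extensionality on
  \<open>carrier G\<close> makes \<open>f\<close> itself unique.\<close>

definition decomposes :: "'a mat \<Rightarrow> ('g \<Rightarrow> 'a mat) \<Rightarrow> bool" where
  "decomposes x f \<longleftrightarrow> f \<in> (\<Pi>\<^sub>E g\<in>carrier G. A g) \<and> finite {g \<in> carrier G. f g \<noteq> 0\<^sub>m m m} \<and>
     x = finsum (UT TYPE('a) m) f {g \<in> carrier G. f g \<noteq> 0\<^sub>m m m}"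

definition part :: "'g \<Rightarrow> 'a mat \<Rightarrow> 'a mat" where
  "part g x = (THE f. decomposes x f) g"

lemma decomposes_unique: "x \<in> C \<Longrightarrow> \<exists>!f. decomposes x f"
  using grading unfolding is_grading_def decomposes_def by simp

lemma decomposes_part:
  assumes "x \<in> C"
  obtains f where "decomposes x f" "\<And>g. part g x = f g"
  using that[OF theI'[OF decomposes_unique[OF assms]]] by (simp add: part_def)

text \<open>Uniqueness identifies any finite sum of elements of distinct degrees with the
  decomposition. Summands may vanish, so \<open>S\<close> is cut down to the support before
  uniqueness is applied.\<close>

lemma part_finsum:
  assumes S: "finite S" "S \<subseteq> carrier G" and f: "\<And>g. g \<in> S \<Longrightarrow> f g \<in> A g"
    and x: "x = finsum (UT TYPE('a) m) f S" and g: "g \<in> carrier G"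
  shows "part g x = (if g \<in> S then f g else 0\<^sub>m m m)"
proof -
  let ?f = "\<lambda>g\<in>carrier G. if g \<in> S then f g else 0\<^sub>m m m"
  have fC: "f \<in> S \<rightarrow> C" using S f A_C by blast
  have sup: "{g \<in> carrier G. ?f g \<noteq> 0\<^sub>m m m} \<subseteq> S" by auto
  have "finsum (UT TYPE('a) m) f S
      = finsum (UT TYPE('a) m) ?f {g \<in> carrier G. ?f g \<noteq> 0\<^sub>m m m}"
    using S sup fC finite_subset[OF sup]
    by (intro UT.add.finprod_mono_neutral_cong_right) auto
  hence "decomposes x ?f"
    unfolding decomposes_def using x f A_zero finite_subset[OF sup S(1)] by (simp add: PiE_iff)
  moreover have "x \<in> C" using x UT.finsum_closed[OF fC] by simp
  ultimately have "(THE f. decomposes x f) = ?f"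
    using decomposes_unique by (metis the1_equality)
  thus ?thesis using g by (simp add: part_def)
qed

lemma part_decomposition:
  assumes "x \<in> C"
  obtains S where "finite S" "S \<subseteq> carrier G"
    "\<And>g. g \<in> carrier G \<Longrightarrow> g \<notin> S \<Longrightarrow> part g x = 0\<^sub>m m m"
    "x = finsum (UT TYPE('a) m) (\<lambda>g. part g x) S"
proof -
  obtain f where f: "decomposes x f" "\<And>g. part g x = f g"
    using decomposes_part[OF assms] by blast
  show ?thesis
    using that[of "{g \<in> carrier G. f g \<noteq> 0\<^sub>m m m}"] f unfolding decomposes_def by auto
qed

lemma part_A:
  assumes "x \<in> C" "g \<in> carrier G"
  shows "part g x \<in> A g"
proof -
  obtain f where f: "decomposes x f" "\<And>g. part g x = f g"
    using decomposes_part[OF assms(1)] by blast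
  have "f g \<in> A g" using f(1) assms(2) PiE_mem[of f "carrier G" A g] unfolding decomposes_def by blast
  thus ?thesis by (simp add: f(2))
qed

lemma part_C: "x \<in> C \<Longrightarrow> g \<in> carrier G \<Longrightarrow> part g x \<in> C"
  by (rule A_C[OF _ part_A])

lemma part_homogeneous:
  assumes "h \<in> carrier G" "g \<in> carrier G" "x \<in> A h"
  shows "part g x = (if g = h then x else 0\<^sub>m m m)"
proof -
  have "x + 0\<^sub>m m m = x" using A_C[OF assms(1,3)] by (simp add: carrier_UT_iff)
  hence "x = finsum (UT TYPE('a) m) (\<lambda>_. x) {h}" using A_C[OF assms(1,3)] by simp
  from part_finsum[OF _ _ _ this assms(2)] assms show ?thesis by simp
qed

lemma part_add:
  assumes x: "x \<in> C" and y: "y \<in> C" and g: "g \<in> carrier G"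
  shows "part g (x + y) = part g x + part g y"
proof -
  obtain S where S: "finite S" "S \<subseteq> carrier G"
    "\<And>g. g \<in> carrier G \<Longrightarrow> g \<notin> S \<Longrightarrow> part g x = 0\<^sub>m m m"
    "x = finsum (UT TYPE('a) m) (\<lambda>g. part g x) S"
    using part_decomposition[OF x] by blast
  obtain T where T: "finite T" "T \<subseteq> carrier G"
    "\<And>g. g \<in> carrier G \<Longrightarrow> g \<notin> T \<Longrightarrow> part g y = 0\<^sub>m m m"
    "y = finsum (UT TYPE('a) m) (\<lambda>g. part g y) T"
    using part_decomposition[OF y] by blast
  have fC: "(\<lambda>g. part g x) \<in> S \<union> T \<rightarrow> C" "(\<lambda>g. part g y) \<in> S \<union> T \<rightarrow> C"
    using part_C x y S(2) T(2) by blast+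
  have "x = finsum (UT TYPE('a) m) (\<lambda>g. part g x) (S \<union> T)"
    using S T fC by (subst S(4), intro UT.add.finprod_mono_neutral_cong_left) auto
  moreover have "y = finsum (UT TYPE('a) m) (\<lambda>g. part g y) (S \<union> T)"
    using S T fC by (subst T(4), intro UT.add.finprod_mono_neutral_cong_left) auto
  ultimately have "x + y = finsum (UT TYPE('a) m) (\<lambda>g. part g x + part g y) (S \<union> T)"
    using UT.finsum_addf[OF fC] by simp
  hence "part g (x + y) = (if g \<in> S \<union> T then part g x + part g y else 0\<^sub>m m m)"
    using S(1,2) T(1,2) x y g by (intro part_finsum) (auto intro!: A_add part_A)
  thus ?thesis using S(3) T(3) g by auto
qed

definition graded_set :: "'a mat set \<Rightarrow> bool" where
  "graded_set S \<longleftrightarrow> S \<subseteq> C \<and> (\<forall>x\<in>S. \<forall>g\<in>carrier G. part g x \<in> S)"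

text \<open>The parts of \<open>x\<close> are homogeneous, lie in \<open>S\<close> and sum to
  \<open>x\<close>. The \<open>add\<close> case ranges over \<open>C\<close> because
  \<open>S\<close> is only closed under parts, and partial sums may leave it.\<close>

lemma homogeneous_induct [consumes 2, case_names homogeneous zero add]:
  assumes S: "graded_set S" and x: "x \<in> S"
    and hom: "\<And>g y. g \<in> carrier G \<Longrightarrow> y \<in> A g \<Longrightarrow> y \<in> S \<Longrightarrow> P y"
    and zero: "P (0\<^sub>m m m)"
    and add: "\<And>y z. y \<in> C \<Longrightarrow> z \<in> C \<Longrightarrow> P y \<Longrightarrow> P z \<Longrightarrow> P (y + z)"
  shows "P x"
proof -
  have xC: "x \<in> C" using S x by (auto simp: graded_set_def)
  have partS: "part g x \<in> S" if "g \<in> carrier G" for g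
    using S x that by (simp add: graded_set_def)
  obtain T where T: "finite T" "T \<subseteq> carrier G"
    "x = finsum (UT TYPE('a) m) (\<lambda>g. part g x) T"
    by (rule part_decomposition[OF xC])
  have "P (finsum (UT TYPE('a) m) (\<lambda>g. part g x) T)"
    using T(1,2)
  proof (induction T rule: finite_induct)
    case empty
    show ?case by (simp add: zero)
  next
    case (insert g T)
    have g: "g \<in> carrier G" and T: "T \<subseteq> carrier G" using insert.prems by auto
    have pi: "(\<lambda>g. part g x) \<in> T \<rightarrow> C" using T part_C[OF xC] by blast
    have "P (part g x + finsum (UT TYPE('a) m) (\<lambda>g. part g x) T)"
      by (rule add[OF part_C[OF xC g] UT.finsum_closed[OF pi]
            hom[OF g part_A[OF xC g] partS[OF g]] insert.IH[OF T]])
    thus ?case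
      using UT.finsum_insert[OF insert.hyps pi part_C[OF xC g]] by simp
  qed
  thus ?thesis using T(3) by simp
qed

lemma homogeneous_induct_C [consumes 1, case_names homogeneous zero add]:
  assumes "x \<in> C" "\<And>g y. g \<in> carrier G \<Longrightarrow> y \<in> A g \<Longrightarrow> P y" "P (0\<^sub>m m m)"
    "\<And>y z. y \<in> C \<Longrightarrow> z \<in> C \<Longrightarrow> P y \<Longrightarrow> P z \<Longrightarrow> P (y + z)"
  shows "P x"
proof (rule homogeneous_induct[of C x P])
  show "P y" if "g \<in> carrier G" "y \<in> A g" for g y using that by (rule assms(2))
  show "P (y + z)" if "y \<in> C" "z \<in> C" "P y" "P z" for y z using that by (rule assms(4))
qed (use part_C assms(1,3) in \<open>auto simp: graded_set_def\<close>)

lemma part_zero: "g \<in> carrier G \<Longrightarrow> part g (0\<^sub>m m m) = 0\<^sub>m m m"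
  using part_homogeneous[of g g "0\<^sub>m m m"] A_zero by simp

lemma part_smult:
  assumes "x \<in> C" "g \<in> carrier G"
  shows "part g (c \<cdot>\<^sub>m x) = c \<cdot>\<^sub>m part g x"
  using assms(1)
proof (induction rule: homogeneous_induct_C)
  case (homogeneous h y)
  have "c \<cdot>\<^sub>m 0\<^sub>m m m = (0\<^sub>m m m :: 'a mat)" by (intro eq_matI) auto
  thus ?case
    using homogeneous assms(2) part_homogeneous[of h g y] part_homogeneous[of h g "c \<cdot>\<^sub>m y"]
    by (simp add: A_smult)
next
  case zero
  have "c \<cdot>\<^sub>m 0\<^sub>m m m = (0\<^sub>m m m :: 'a mat)" by (intro eq_matI) auto
  thus ?case using assms(2) part_zero by simp
next
  case (add y z)
  show ?case
    using add assms(2) add_smult_distrib_left_mat[of y m m z c]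
      add_smult_distrib_left_mat[of "part g y" m m "part g z" c]
    by (simp add: part_add part_C carrier_UT_mat[where ty="TYPE('a)"])
qed

lemma degree_unique:
  "g \<in> carrier G \<Longrightarrow> h \<in> carrier G \<Longrightarrow> x \<in> A g \<Longrightarrow> x \<in> A h \<Longrightarrow> x \<noteq> 0\<^sub>m m m \<Longrightarrow> g = h"
  using part_homogeneous[of g g x] part_homogeneous[of h g x] by (simp split: if_splits)

subsection \<open>The radical and the diagonal\<close>

text \<open>Left multiplication by an element of degree \<open>h\<close> shifts degrees from
  \<open>g\<close> to \<open>h \<otimes> g\<close>, and cancellation in \<open>G\<close> keeps
  distinct degrees distinct.\<close>

lemma part_mult_left:
  assumes "h \<in> carrier G" "g \<in> carrier G" "a \<in> A h" "x \<in> C"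
  shows "part (h \<otimes> g) (a * x) = a * part g x"
  using assms(4)
proof (induction rule: homogeneous_induct_C)
  case (homogeneous k y)
  have "a * y \<in> A (h \<otimes> k)" by (rule A_mult) (use assms homogeneous in auto)
  hence "part (h \<otimes> g) (a * y) = (if h \<otimes> g = h \<otimes> k then a * y else 0\<^sub>m m m)"
    using assms homogeneous by (intro part_homogeneous) auto
  moreover have "a * 0\<^sub>m m m = 0\<^sub>m m m"
    using A_C[OF assms(1,3)] by (auto simp: carrier_UT_iff)
  ultimately show ?case
    using assms homogeneous by (simp add: part_homogeneous[of k])
next
  case zero
  have "a * 0\<^sub>m m m = 0\<^sub>m m m"
    using A_C[OF assms(1,3)] by (auto simp: carrier_UT_iff)
  thus ?case using assms by (simp add: part_zero)
next
  case (add y z)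
  have a: "a \<in> C" using A_C assms by blast
  show ?case
    using add assms a part_C[of y g] part_C[of z g]
    by (simp add: part_add UT_distrib[where ty="TYPE('a)"])
qed

lemma part_mult_right:
  assumes "h \<in> carrier G" "g \<in> carrier G" "a \<in> A h" "x \<in> C"
  shows "part (g \<otimes> h) (x * a) = part g x * a"
  using assms(4)
proof (induction rule: homogeneous_induct_C)
  case (homogeneous k y)
  have "y * a \<in> A (k \<otimes> h)" by (rule A_mult) (use assms homogeneous in auto)
  hence "part (g \<otimes> h) (y * a) = (if g \<otimes> h = k \<otimes> h then y * a else 0\<^sub>m m m)"
    using assms homogeneous by (intro part_homogeneous) auto
  moreover have "0\<^sub>m m m * a = 0\<^sub>m m m"
    using A_C[OF assms(1,3)] by (auto simp: carrier_UT_iff)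
  ultimately show ?case
    using assms homogeneous by (simp add: part_homogeneous[of k])
next
  case zero
  have "0\<^sub>m m m * a = 0\<^sub>m m m"
    using A_C[OF assms(1,3)] by (auto simp: carrier_UT_iff)
  thus ?case using assms by (simp add: part_zero)
next
  case (add y z)
  have a: "a \<in> C" using A_C assms by blast
  show ?case
    using add assms a part_C[of y g] part_C[of z g]
    by (simp add: part_add UT_distrib[where ty="TYPE('a)"])
qed

text \<open>The Jacobson radical of the algebra, described entrywise.\<close>

definition J :: "'a mat set" where
  "J = {x \<in> C. \<forall>i<m. x $$ (i, i) = 0}"

lemma J_C: "x \<in> J \<Longrightarrow> x \<in> C" by (simp add: J_def)

lemma J_entry: "x \<in> J \<Longrightarrow> i < m \<Longrightarrow> j < m \<Longrightarrow> j \<le> i \<Longrightarrow> x $$ (i, j) = 0"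
  by (cases "i = j") (auto simp: J_def carrier_UT_lower)

lemma commutator_J: "x \<in> C \<Longrightarrow> y \<in> C \<Longrightarrow> x * y - y * x \<in> J"
  unfolding J_def using mult_diag[of x "TYPE('a)" m y] mult_diag[of y "TYPE('a)" m x]
  by (simp del: index_mult_mat(1))

text \<open>Although \<open>G\<close> need not be commutative, the involution forces degrees of homogeneous
  elements with nonzero product to commute.\<close>

lemma degrees_commute:
  assumes "g \<in> carrier G" "h \<in> carrier G" "x \<in> A g" "y \<in> A h" "x * y \<noteq> 0\<^sub>m m m"
  shows "g \<otimes> h = h \<otimes> g"
proof -
  have xy: "x \<in> C" "y \<in> C" using assms A_C by blast+
  have "s (x * y) \<in> A (g \<otimes> h)" by (intro s_A A_mult m_closed assms)
  moreover have "s (x * y) \<in> A (h \<otimes> g)"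
    using xy assms by (simp add: s_mult A_mult s_A)
  moreover have "s (x * y) \<noteq> 0\<^sub>m m m" using s_eq_zero[of "x * y"] assms(5) xy by auto
  ultimately show ?thesis using degree_unique assms(1,2) m_closed by blast
qed

text \<open>If \<open>x * y\<close> vanishes, only \<open>- (y * x)\<close> is left, which is
  homogeneous without any commutation of degrees; otherwise the degrees commute and both products
  lie in the same component.\<close>

lemma commutator_homogeneous:
  assumes "g \<in> carrier G" "h \<in> carrier G" "x \<in> A g" "y \<in> A h"
  obtains k where "k \<in> carrier G" "x * y - y * x \<in> A k"
proof (cases "x * y = 0\<^sub>m m m")
  case True
  have xy: "x \<in> C" "y \<in> C" using assms A_C by blast+
  have "x * y - y * x = - (y * x)" unfolding True using xy by (intro eq_matI) auto
  moreover have "- (y * x) \<in> A (h \<otimes> g)" using assms by (intro A_uminus A_mult) auto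
  ultimately show ?thesis using that assms by (metis m_closed)
next
  case False
  hence "g \<otimes> h = h \<otimes> g" using degrees_commute assms by blast
  hence "x * y - y * x \<in> A (g \<otimes> h)"
    using A_mult[OF assms(1,2,3,4)] A_mult[OF assms(2,1,4,3)] assms by (intro A_diff) auto
  thus ?thesis using that assms by blast
qed

lemma J_add: "x \<in> J \<Longrightarrow> y \<in> J \<Longrightarrow> x + y \<in> J"
  by (auto simp: J_def)

lemma J_zero: "0\<^sub>m m m \<in> J"
  by (auto simp: J_def)

text \<open>The bracket is bilinear, which reduces the claim to homogeneous arguments; there the
  part is the whole commutator or zero, and \<open>J\<close> is closed under the sums that
  arise.\<close>

lemma part_commutator:
  assumes "x \<in> C" "y \<in> C" "g \<in> carrier G"
  shows "part g (x * y - y * x) \<in> J"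
  using assms(1)
proof (induction rule: homogeneous_induct_C)
  case (homogeneous h x)
  have x: "x \<in> C" using homogeneous A_C by blast
  show ?case using assms(2)
  proof (induction rule: homogeneous_induct_C)
    case (homogeneous k y)
    obtain l where "l \<in> carrier G" "x * y - y * x \<in> A l"
      using commutator_homogeneous[OF \<open>h \<in> _\<close> homogeneous(1) \<open>x \<in> A h\<close> homogeneous(2)] .
    thus ?case
      using part_homogeneous[OF _ assms(3), of l "x * y - y * x"] J_zero
        commutator_J[OF x A_C[OF homogeneous(1,2)]] by simp
  next
    case zero
    have "x * 0\<^sub>m m m - 0\<^sub>m m m * x = 0\<^sub>m m m" using x by (auto simp: carrier_UT_iff)
    thus ?case using assms(3) part_zero J_zero by simp
  next
    case (add y z)
    have "x * (y + z) - (y + z) * x = (x * y - y * x) + (x * z - z * x)"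
      unfolding UT_distrib[OF x add(1,2)] UT_distrib[OF add(1,2) x]
      using x add(1,2) by (intro eq_matI) (auto simp del: index_mult_mat(1))
    thus ?case
      using x add assms(3) part_add[of "x * y - y * x" "x * z - z * x" g] J_add by simp
  qed
next
  case zero
  have "0\<^sub>m m m * y - y * 0\<^sub>m m m = 0\<^sub>m m m" using assms(2) by (auto simp: carrier_UT_iff)
  thus ?case using assms(3) part_zero J_zero by simp
next
  case (add x z)
  have "(x + z) * y - y * (x + z) = (x * y - y * x) + (z * y - y * z)"
    unfolding UT_distrib[OF assms(2) add(1,2)] UT_distrib[OF add(1,2) assms(2)]
    using assms(2) add(1,2) by (intro eq_matI) (auto simp del: index_mult_mat(1))
  thus ?case
    using assms(2) add assms(3) part_add[of "x * y - y * x" "z * y - y * z" g] J_add by simp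
qed

text \<open>Bracketing with \<open>d\<close> multiplies the entry at \<open>(i, j)\<close> by
  \<open>i - j\<close>, which is nonzero off the diagonal in characteristic zero. A single
  commutator therefore suffices, with the same \<open>d\<close> for every \<open>x\<close>.\<close>

lemma J_is_commutator:
  assumes "x \<in> J"
  obtains d y where "d \<in> C" "y \<in> C" "x = d * y - y * d"
proof -
  define d :: "'a mat" where "d = mat m m (\<lambda>(i, j). if i = j then of_nat i else 0)"
  \<comment> \<open>On the diagonal the denominator is \<open>0\<close>, so the quotient is
    \<open>0\<close> by convention; the bracket with \<open>d\<close> has zero diagonal in any
    case.\<close>
  define y where "y = mat m m (\<lambda>(i, j). x $$ (i, j) / (of_nat i - of_nat j))"
  have x: "x \<in> C" using assms J_C by blast
  have d: "d \<in> C" unfolding d_def by (rule diag_closed)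
  have y: "y \<in> C" using x by (auto simp: y_def carrier_UT_iff)
  have "x = d * y - y * d"
  proof (rule UT_eqI[OF x])
    show "d * y - y * d \<in> C" using d y by simp
    fix i j assume ij: "i \<le> j" "j < m"
    hence "(d * y - y * d) $$ (i, j) = of_nat i * y $$ (i, j) - y $$ (i, j) * of_nat j"
      using d y diag_mult_left[OF y, of i j of_nat] diag_mult_right[OF y, of i j of_nat]
      unfolding d_def[symmetric] by (simp del: index_mult_mat(1))
    also have "\<dots> = x $$ (i, j)"
    proof (cases "i = j")
      case False
      hence "(of_nat i :: 'a) - of_nat j \<noteq> 0" by simp
      thus ?thesis using ij by (simp add: y_def diff_divide_distrib[symmetric] left_diff_distrib[symmetric]
            mult.commute[of _ "of_nat j"])
    qed (use ij J_entry[OF assms, of i i] in simp)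
    finally show "x $$ (i, j) = (d * y - y * d) $$ (i, j)" by simp
  qed
  thus ?thesis using that d y by blast
qed

lemma J_part: "x \<in> J \<Longrightarrow> g \<in> carrier G \<Longrightarrow> part g x \<in> J"
  by (metis J_is_commutator part_commutator)

lemma graded_J: "graded_set J"
  using J_part by (auto simp: graded_set_def J_def)

text \<open>An anti-automorphism sends commutators to commutators, and \<open>J\<close> consists of
  commutators.\<close>

lemma s_J:
  assumes "x \<in> J"
  shows "s x \<in> J"
proof -
  obtain d y where "d \<in> C" "y \<in> C" "x = d * y - y * d"
    using J_is_commutator[OF assms] .
  thus ?thesis using commutator_J[of "s y" "s d"] by (simp add: s_diff s_mult)
qed

section \<open>Ideals in the first row and in the last column\<close>

definition row_part :: "nat \<Rightarrow> 'a mat set" where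
  "row_part j = {x \<in> C. \<forall>i<m. \<forall>k<m. x $$ (i, k) \<noteq> 0 \<longrightarrow> i = 0 \<and> j \<le> k}"

text \<open>The mirror image of \<open>row_part j\<close> under the reflection: rows are counted
  from the bottom, so that \<open>j\<close> has the same meaning in both chains.\<close>

definition col_part :: "nat \<Rightarrow> 'a mat set" where
  "col_part j = {x \<in> C. \<forall>i<m. \<forall>k<m. x $$ (i, k) \<noteq> 0 \<longrightarrow> k = m - 1 \<and> i + j < m}"

lemma superdiag_unit_J: "Suc i < m \<Longrightarrow> matrix_unit m i (Suc i) \<in> J"
  by (simp add: J_def matrix_unit_closed)

text \<open>This describes the first row through \<open>J\<close> alone, which lets gradedness pass
  from \<open>J\<close> to it. Conversely, multiplying by the superdiagonal unit at
  \<open>(l, Suc l)\<close> lifts row \<open>Suc l\<close> of \<open>x\<close> into row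
  \<open>l\<close>, so each row except the first must vanish.\<close>

lemma row_part_0: "x \<in> row_part 0 \<longleftrightarrow> x \<in> C \<and> (\<forall>y\<in>J. y * x = 0\<^sub>m m m)"
proof (intro iffI conjI ballI)
  fix y assume x: "x \<in> row_part 0" and y: "y \<in> J"
  hence xy: "x \<in> C" "y \<in> C" by (auto simp: row_part_def J_def)
  show "y * x = 0\<^sub>m m m"
  proof (rule UT_eqI[OF UT_closed(5)[OF xy(2,1)] UT_consts(1)])
    fix i j assume ij: "i \<le> j" "j < m"
    have "(y * x) $$ (i, j) = (\<Sum>k<m. y $$ (i, k) * x $$ (k, j))"
      using mult_entry[OF xy(2,1)] ij by simp
    also have "\<dots> = 0"
    proof (rule sum.neutral, rule ballI)
      fix k assume "k \<in> {..<m}"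
      thus "y $$ (i, k) * x $$ (k, j) = 0"
        using x ij J_entry[OF y, of i 0] by (cases "k = 0") (auto simp: row_part_def)
    qed
    finally show "(y * x) $$ (i, j) = 0\<^sub>m m m $$ (i, j)" using ij by simp
  qed
next
  assume *: "x \<in> C \<and> (\<forall>y\<in>J. y * x = 0\<^sub>m m m)"
  have "x $$ (i, k) = 0" if i: "0 < i" "i < m" "k < m" for i k
  proof -
    obtain l where l: "i = Suc l" using i by (cases i) auto
    have "(matrix_unit m l (Suc l) * x) $$ (l, k) = x $$ (i, k)"
      using matrix_unit_mult_left[of x "TYPE('a)" m l "Suc l" l k] * i l by simp
    moreover have "matrix_unit m l (Suc l) * x = 0\<^sub>m m m"
      using * superdiag_unit_J[of l] i l by blast
    ultimately show ?thesis using i l by simp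
  qed
  thus "x \<in> row_part 0" using * unfolding row_part_def by blast
qed (simp add: row_part_def)

lemma col_part_0:
  assumes x: "x \<in> C" and *: "\<And>y. y \<in> J \<Longrightarrow> x * y = 0\<^sub>m m m"
  shows "x \<in> col_part 0"
proof -
  have "x $$ (i, k) = 0" if i: "i < m" "k < m" "k \<noteq> m - 1" for i k
  proof -
    have "(x * matrix_unit m k (Suc k)) $$ (i, Suc k) = x $$ (i, k)"
      using matrix_unit_mult_right[of x "TYPE('a)" m k "Suc k" i "Suc k"] x i by simp
    moreover have "x * matrix_unit m k (Suc k) = 0\<^sub>m m m"
      using * superdiag_unit_J[of k] i by simp
    ultimately show ?thesis using i by simp
  qed
  thus ?thesis using x unfolding col_part_def by auto
qed

lemma row_part_mult_J:
  assumes "x \<in> row_part j" "y \<in> J"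
  shows "x * y \<in> row_part (Suc j)"
proof -
  have xy: "x \<in> C" "y \<in> C" using assms by (auto simp: row_part_def J_def)
  have "i = 0 \<and> Suc j \<le> k" if "i < m" "k < m" "(x * y) $$ (i, k) \<noteq> 0" for i k
  proof -
    have "(\<Sum>l<m. x $$ (i, l) * y $$ (l, k)) \<noteq> 0"
      using that mult_entry[OF xy] by metis
    then obtain l where l: "l < m" "x $$ (i, l) \<noteq> 0" "y $$ (l, k) \<noteq> 0"
      by (metis (no_types, lifting) lessThan_iff mult_zero_left mult_zero_right sum.neutral)
    hence "i = 0" "j \<le> l" using assms(1) that by (auto simp: row_part_def)
    moreover have "l < k" using J_entry[OF assms(2), of l k] l that by force
    ultimately show ?thesis by simp
  qed
  thus ?thesis using xy by (simp add: row_part_def)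
qed

lemma J_mult_col_part:
  assumes "y \<in> J" "x \<in> col_part j"
  shows "y * x \<in> col_part (Suc j)"
proof -
  have xy: "y \<in> C" "x \<in> C" using assms by (auto simp: col_part_def J_def)
  have "k = m - 1 \<and> i + Suc j < m" if "i < m" "k < m" "(y * x) $$ (i, k) \<noteq> 0" for i k
  proof -
    have "(\<Sum>l<m. y $$ (i, l) * x $$ (l, k)) \<noteq> 0"
      using that mult_entry[OF xy] by metis
    then obtain l where l: "l < m" "y $$ (i, l) \<noteq> 0" "x $$ (l, k) \<noteq> 0"
      by (metis (no_types, lifting) lessThan_iff mult_zero_left mult_zero_right sum.neutral)
    hence "k = m - 1" "l + j < m" using assms(2) that by (auto simp: col_part_def)
    moreover have "i < l" using J_entry[OF assms(1), of i l] l that by force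
    ultimately show ?thesis by simp
  qed
  thus ?thesis using xy by (simp add: col_part_def)
qed

text \<open>Moving the first row of \<open>x\<close> down to row \<open>j\<close> gives
  \<open>y\<close>; it is strictly triangular because the nonzero entries of \<open>x\<close> start
  after column \<open>j\<close>. Thus each ideal is the previous one times \<open>J\<close>, with a
  single product and no sum.\<close>

lemma row_part_Suc_factor:
  assumes x: "x \<in> row_part (Suc j)" and j: "j < m"
  obtains y where "y \<in> J" "x = matrix_unit m 0 j * y"
proof -
  have xC: "x \<in> C" using x by (simp add: row_part_def)
  have x0: "x $$ (i, k) = 0" if "i < m" "k < m" "i \<noteq> 0 \<or> k \<le> j" for i k
    using x that not_less_eq_eq unfolding row_part_def by blast
  define y where "y = mat m m (\<lambda>(a, b). if a = j then x $$ (0, b) else 0)"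
  have y: "y \<in> J"
    using x0 j by (auto simp: y_def J_def carrier_UT_iff)
  have "x = matrix_unit m 0 j * y"
  proof (rule UT_eqI[OF xC UT_closed(5)[OF matrix_unit_closed[OF le0] J_C[OF y]]])
    fix i k assume ik: "i \<le> k" "k < m"
    show "x $$ (i, k) = (matrix_unit m 0 j * y) $$ (i, k)"
      using matrix_unit_mult_left[OF J_C[OF y] le0 j, of i k] ik j x0 by (auto simp: y_def)
  qed
  thus ?thesis using that y by blast
qed

lemma matrix_unit_row_part: "j < m \<Longrightarrow> matrix_unit m 0 j \<in> row_part j"
  by (auto simp: row_part_def matrix_unit_closed split: if_splits)

lemma row_part_add: "x \<in> row_part j \<Longrightarrow> y \<in> row_part j \<Longrightarrow> x + y \<in> row_part j"
  by (auto simp: row_part_def)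
    (metis add.right_neutral)+

lemma row_part_zero: "0\<^sub>m m m \<in> row_part j"
  by (auto simp: row_part_def)

lemma row_part_C: "row_part j \<subseteq> C"
  by (auto simp: row_part_def)

text \<open>For \<open>v\<close> of degree \<open>h\<close>, the part of \<open>v * y\<close> of
  degree \<open>g\<close> is \<open>v\<close> times the part of \<open>y\<close> of degree
  \<open>inv h \<otimes> g\<close>, and the latter stays in \<open>J\<close>. Hence only
  \<open>v\<close> has to be split into homogeneous elements.\<close>

lemma part_mult_row_part:
  assumes "graded_set (row_part j)" "v \<in> row_part j" and y: "y \<in> J" and g: "g \<in> carrier G"
  shows "part g (v * y) \<in> row_part (Suc j)"
  using assms(1,2)
proof (induction rule: homogeneous_induct)
  case (homogeneous h v)
  have vC: "v \<in> C" using homogeneous A_C by blast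
  let ?k = "inv h \<otimes> g"
  have k: "?k \<in> carrier G" "h \<otimes> ?k = g" using homogeneous g by (simp_all add: inv_solve_left m_assoc[symmetric])
  have "part (h \<otimes> ?k) (v * y) = v * part ?k y"
    using homogeneous k y J_C by (intro part_mult_left) auto
  thus ?case using row_part_mult_J[OF homogeneous(3) J_part[OF y k(1)]] k(2) by simp
next
  case zero
  have "0\<^sub>m m m * y = 0\<^sub>m m m" using J_C[OF y] by (auto simp: carrier_UT_iff)
  thus ?case using g part_zero row_part_zero by simp
next
  case (add u v)
  thus ?case using J_C[OF y] g row_part_add
    by (simp add: UT_distrib[where ty="TYPE('a)"] part_add)
qed

lemma graded_row_part: "j \<le> m \<Longrightarrow> graded_set (row_part j)"
proof (induction j)
  case 0
  have "part g x \<in> row_part 0" if x: "x \<in> row_part 0" and g: "g \<in> carrier G" for g x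
  proof -
    have xC: "x \<in> C" using x row_part_C by blast
    \<comment> \<open>Annihilation by \<open>J\<close> may be tested on homogeneous
      \<open>y\<close>, where \<open>y * part g x\<close> is a part of \<open>y * x\<close>, that
      is, of zero.\<close>
    have "y * part g x = 0\<^sub>m m m" if "y \<in> J" for y
      using graded_J that
    proof (induction rule: homogeneous_induct)
      case (homogeneous h y)
      have "y * x = 0\<^sub>m m m" using x homogeneous(3) row_part_0 by blast
      thus ?case using part_mult_left[OF homogeneous(1) g homogeneous(2) xC]
          part_zero homogeneous g by simp
    next
      case zero
      show ?case using part_C[OF xC g] by (auto simp: carrier_UT_iff)
    next
      case (add y z)
      have "0\<^sub>m m m + 0\<^sub>m m m = (0\<^sub>m m m :: 'a mat)" by auto
      thus ?case using add part_C[OF xC g] by (simp add: UT_distrib[where ty="TYPE('a)"])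
    qed
    thus ?thesis using part_C[OF xC g] row_part_0 by blast
  qed
  thus ?case using row_part_C by (auto simp: graded_set_def)
next
  case (Suc j)
  have "part g x \<in> row_part (Suc j)" if x: "x \<in> row_part (Suc j)" and g: "g \<in> carrier G" for g x
  proof -
    obtain y where y: "y \<in> J" "x = matrix_unit m 0 j * y"
      using row_part_Suc_factor[OF x] Suc.prems by auto
    thus ?thesis using part_mult_row_part[of j "matrix_unit m 0 j" y g] Suc
        matrix_unit_row_part[of j] g by simp
  qed
  thus ?case using row_part_C by (auto simp: graded_set_def)
qed

text \<open>For homogeneous \<open>v\<close> in \<open>row_part j\<close>, the product
  \<open>v * a\<close> is congruent to \<open>a $$ (j, j)\<close> times \<open>v\<close> modulo
  \<open>row_part (Suc j)\<close>. The two sides have different degrees, so gradedness of the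
  smaller ideal puts the second one into it, although its leading entry is nonzero unless
  \<open>a $$ (j, j)\<close> vanishes.\<close>

lemma diag_zero:
  assumes g: "g \<in> carrier G" "g \<noteq> \<one>" and a: "a \<in> A g" and j: "j < m"
  shows "a $$ (j, j) = 0"
proof -
  have aC: "a \<in> C" using A_C g a by blast
  \<comment> \<open>If every homogeneous element of \<open>row_part j\<close> had entry
    \<open>0\<close> at \<open>(0, j)\<close>, additivity would force the same for
    \<open>matrix_unit m 0 j\<close>.\<close>
  have "\<exists>h v. h \<in> carrier G \<and> v \<in> A h \<and> v \<in> row_part j \<and> v $$ (0, j) \<noteq> 0"
  proof (rule ccontr)
    assume no: "\<nexists>h v. h \<in> carrier G \<and> v \<in> A h \<and> v \<in> row_part j \<and> v $$ (0, j) \<noteq> 0"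
    have "matrix_unit m 0 j $$ (0, j) = (0 :: 'a)"
      using graded_row_part[OF less_imp_le[OF j]] matrix_unit_row_part[OF j]
    proof (induction rule: homogeneous_induct)
      case (add y z)
      thus ?case using j by simp
    qed (use j no in auto)
    thus False using j by simp
  qed
  then obtain h v where h: "h \<in> carrier G" and v: "v \<in> A h" "v \<in> row_part j" "v $$ (0, j) \<noteq> 0"
    by blast
  have vC: "v \<in> C" using v row_part_C by blast
  define w where "w = v * a + (- a $$ (j, j)) \<cdot>\<^sub>m v"
  have va: "(v * a) $$ (i, k) = (if i = 0 \<and> k = j then v $$ (0, j) * a $$ (j, j) else 0)"
    if "i < m" "k < m" "i \<noteq> 0 \<or> k \<le> j" for i k
  proof -
    have "(v * a) $$ (i, k) = (\<Sum>l<m. v $$ (i, l) * a $$ (l, k))"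
      using mult_entry[OF vC aC] that by simp
    also have "\<dots> = (\<Sum>l<m. if l = j \<and> i = 0 \<and> k = j then v $$ (0, j) * a $$ (j, j) else 0)"
    proof (rule sum.cong)
      fix l assume "l \<in> {..<m}"
      hence l: "l < m" by simp
      have "a $$ (l, k) = 0" if "k < l" using carrier_UT_lower[OF aC that l] .
      moreover have "v $$ (i, l) = 0" if "i \<noteq> 0 \<or> l < j" using v(2) that l \<open>i < m\<close> not_less
        unfolding row_part_def by blast
      ultimately show "v $$ (i, l) * a $$ (l, k)
          = (if l = j \<and> i = 0 \<and> k = j then v $$ (0, j) * a $$ (j, j) else 0)"
        using that by (cases "l < j"; cases "k < l") auto
    qed simp
    also have "\<dots> = (if i = 0 \<and> k = j then v $$ (0, j) * a $$ (j, j) else 0)"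
      using j by simp
    finally show ?thesis .
  qed
  have "w \<in> row_part (Suc j)"
  proof -
    have "w $$ (i, k) = 0" if "i < m" "k < m" "i \<noteq> 0 \<or> k \<le> j" for i k
    proof -
      have "v $$ (i, k) = 0" if "i \<noteq> 0 \<or> k < j" using v(2) that \<open>i < m\<close> \<open>k < m\<close> not_less
        unfolding row_part_def by blast
      thus ?thesis using va[OF that] that vC aC
        by (auto simp: w_def simp del: index_mult_mat(1))
    qed
    moreover have "w \<in> C" using vC aC by (simp add: w_def)
    ultimately show ?thesis unfolding row_part_def using not_less_eq_eq by blast
  qed
  hence "part h w \<in> row_part (Suc j)" using graded_row_part[of "Suc j"] h j by (simp add: graded_set_def)
  moreover have "part h w = (- a $$ (j, j)) \<cdot>\<^sub>m v"
  proof -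
    have "h \<otimes> g \<noteq> h" using g h by simp
    hence "part h (v * a) = 0\<^sub>m m m"
      using part_homogeneous[OF m_closed[OF h g(1)] h A_mult[OF h g(1) v(1) a]] by simp
    moreover have "part h ((- a $$ (j, j)) \<cdot>\<^sub>m v) = (- a $$ (j, j)) \<cdot>\<^sub>m v"
      using part_homogeneous[OF h h A_smult[OF h v(1)]] by simp
    ultimately have "part h w = 0\<^sub>m m m + (- a $$ (j, j)) \<cdot>\<^sub>m v"
      unfolding w_def using part_add[of "v * a" "(- a $$ (j, j)) \<cdot>\<^sub>m v" h] vC aC h by simp
    thus ?thesis using vC by (simp add: carrier_UT_iff)
  qed
  ultimately have "((- a $$ (j, j)) \<cdot>\<^sub>m v) $$ (0, j) = 0"
    using j unfolding row_part_def by force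
  thus ?thesis using v(3) vC j by simp
qed

text \<open>The involution turns left annihilation by \<open>J\<close> into right annihilation,
  which settles \<open>j = 0\<close>. Each further unit arises by one factor from \<open>J\<close>
  on the right, which \<open>s\<close> moves to the left.\<close>

lemma s_unit_col_part: "j < m \<Longrightarrow> s (matrix_unit m 0 j) \<in> col_part j"
proof (induction j)
  case 0
  let ?x = "matrix_unit m 0 0 :: 'a mat"
  have x: "?x \<in> row_part 0" using matrix_unit_row_part 0 by blast
  hence xC: "?x \<in> C" using row_part_C by blast
  have "s ?x * y = 0\<^sub>m m m" if "y \<in> J" for y
  proof -
    have "s y * ?x = 0\<^sub>m m m" using x row_part_0 s_J[OF that] by blast
    hence "s (s y * ?x) = 0\<^sub>m m m" using s_zero by simp
    thus ?thesis using xC J_C[OF that] by (simp add: s_mult s_s)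
  qed
  thus ?case using col_part_0[of "s ?x"] xC by simp
next
  case (Suc j)
  have "s (matrix_unit m 0 (Suc j)) = s (matrix_unit m j (Suc j)) * s (matrix_unit m 0 j)"
    using Suc.prems matrix_unit_mult[of 0 j "Suc j" m, where 'a='a]
    by (simp add: s_mult[symmetric] matrix_unit_closed)
  thus ?case
    using J_mult_col_part[OF s_J[OF superdiag_unit_J[OF Suc.prems]] Suc.IH] Suc.prems by simp
qed

text \<open>Downward induction from \<open>j = m - 1\<close>, where \<open>col_part m\<close> is
  zero and \<open>s\<close> is injective. Together with the previous lemma this makes the entry of
  \<open>s (matrix_unit m 0 j)\<close> at \<open>(m - 1 - j, m - 1)\<close> nonzero.\<close>

lemma s_unit_not_col_part: "j < m \<Longrightarrow> s (matrix_unit m 0 j) \<notin> col_part (Suc j)"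
proof (induction "m - 1 - j" arbitrary: j)
  case 0
  hence j: "Suc j = m" by simp
  show ?case
  proof
    assume "s (matrix_unit m 0 j) \<in> col_part (Suc j)"
    hence "s (matrix_unit m 0 j) = 0\<^sub>m m m"
      using j by (intro eq_matI) (auto simp: col_part_def)
    hence "matrix_unit m 0 j = (0\<^sub>m m m :: 'a mat)"
      by (rule s_eq_zero[rotated]) (simp add: matrix_unit_closed)
    from arg_cong[OF this, of "\<lambda>x. x $$ (0, j)"] show False using j by simp
  qed
next
  case (Suc d)
  hence j: "Suc j < m" by simp
  have "s (matrix_unit m 0 (Suc j)) = s (matrix_unit m j (Suc j)) * s (matrix_unit m 0 j)"
    using j matrix_unit_mult[of 0 j "Suc j" m, where 'a='a]
    by (simp add: s_mult[symmetric] matrix_unit_closed)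
  moreover have "s (matrix_unit m 0 (Suc j)) \<notin> col_part (Suc (Suc j))"
    using Suc j by simp
  ultimately show ?case
    using J_mult_col_part[OF s_J[OF superdiag_unit_J[OF j]]] by metis
qed

text \<open>The involution reverses the diagonal: compare the right action of \<open>a\<close> on
  \<open>matrix_unit m 0 j\<close> with the left action of \<open>s a\<close> on its image.\<close>

lemma s_diag:
  assumes a: "a \<in> C" and j: "j < m"
  shows "s a $$ (m - 1 - j, m - 1 - j) = a $$ (j, j)"
proof -
  let ?e = "matrix_unit m 0 j :: 'a mat"
  let ?j = "m - 1 - j"
  have e: "?e \<in> C" by (simp add: matrix_unit_closed)
  have z: "s ?e \<in> col_part j" using s_unit_col_part j .
  hence zC: "s ?e \<in> C" by (simp add: col_part_def)
  have z0: "s ?e $$ (?j, m - 1) \<noteq> 0"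
  proof
    assume 0: "s ?e $$ (?j, m - 1) = 0"
    have "s ?e \<in> col_part (Suc j)"
      unfolding col_part_def
    proof (safe, fact zC)
      fix i k assume ik: "i < m" "k < m" "s ?e $$ (i, k) \<noteq> 0"
      hence "k = m - 1" "i + j < m" using z by (auto simp: col_part_def)
      moreover have "i \<noteq> ?j" using ik 0 calculation by auto
      ultimately show "k = m - 1" "i + Suc j < m" by auto
    qed
    thus False using s_unit_not_col_part j by blast
  qed
  \<comment> \<open>Modulo \<open>row_part (Suc j)\<close>, right multiplication by \<open>a\<close>
    scales \<open>?e\<close> by its diagonal entry; the factorization through \<open>J\<close> lets
    \<open>s\<close> carry this to a congruence modulo \<open>col_part (Suc j)\<close>.\<close>
  have "?e * a - a $$ (j, j) \<cdot>\<^sub>m ?e \<in> row_part (Suc j)"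
    unfolding row_part_def
  proof (intro CollectI conjI allI impI)
    fix i k assume ik: "i < m" "k < m" "(?e * a - a $$ (j, j) \<cdot>\<^sub>m ?e) $$ (i, k) \<noteq> 0"
    have "(?e * a - a $$ (j, j) \<cdot>\<^sub>m ?e) $$ (i, k)
        = (if i = 0 then a $$ (j, k) - (if k = j then a $$ (j, j) else 0) else 0)"
      using ik a e matrix_unit_mult_left[OF a le0 j ik(1,2)] by (simp del: index_mult_mat(1))
    hence "i = 0" "k \<noteq> j" "a $$ (j, k) \<noteq> 0" using ik(3) by (auto split: if_splits)
    thus "i = 0" "Suc j \<le> k" using carrier_UT_lower[OF a _ j, of k] by force+
  qed (use a e in simp)
  then obtain y where y: "y \<in> J" "?e * a - a $$ (j, j) \<cdot>\<^sub>m ?e = ?e * y"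
    using row_part_Suc_factor[OF _ j] by blast
  have "s a * s ?e - a $$ (j, j) \<cdot>\<^sub>m s ?e = s y * s ?e"
    using arg_cong[OF y(2), of s] a e J_C[OF y(1)] by (simp add: s_mult s_diff s_smult)
  also have "\<dots> \<in> col_part (Suc j)" using J_mult_col_part[OF s_J[OF y(1)] z] .
  finally have *: "s a * s ?e - a $$ (j, j) \<cdot>\<^sub>m s ?e \<in> col_part (Suc j)" .
  have "(s a * s ?e - a $$ (j, j) \<cdot>\<^sub>m s ?e) $$ (?j, m - 1) = 0"
  proof (rule ccontr)
    assume "(s a * s ?e - a $$ (j, j) \<cdot>\<^sub>m s ?e) $$ (?j, m - 1) \<noteq> 0"
    moreover have "?j < m" "m - 1 < m" using j by auto
    ultimately have "?j + Suc j < m" using * unfolding col_part_def by blast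
    thus False using j by simp
  qed
  \<comment> \<open>For \<open>k < ?j\<close> the factor from \<open>s a\<close> vanishes by
    triangularity, for \<open>?j < k\<close> the factor from \<open>s ?e\<close> vanishes by
    \<open>z\<close>.\<close>
  moreover have "(s a * s ?e) $$ (?j, m - 1) = s a $$ (?j, ?j) * s ?e $$ (?j, m - 1)"
  proof -
    have "(s a * s ?e) $$ (?j, m - 1) = (\<Sum>k<m. s a $$ (?j, k) * s ?e $$ (k, m - 1))"
      using mult_entry[OF s_closed[OF a] zC] j by simp
    also have "\<dots> = (\<Sum>k<m. if k = ?j then s a $$ (?j, ?j) * s ?e $$ (?j, m - 1) else 0)"
    proof (rule sum.cong)
      fix k assume "k \<in> {..<m}"
      hence k: "k < m" by simp
      have "s a $$ (?j, k) = 0" if "k < ?j"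
        using carrier_UT_lower[OF s_closed[OF a] that] j by simp
      moreover have "s ?e $$ (k, m - 1) = 0" if "?j < k"
      proof (rule ccontr)
        assume "s ?e $$ (k, m - 1) \<noteq> 0"
        moreover have "m - 1 < m" using j by simp
        ultimately have "k + j < m" using z k unfolding col_part_def by blast
        thus False using that by simp
      qed
      ultimately show "s a $$ (?j, k) * s ?e $$ (k, m - 1)
          = (if k = ?j then s a $$ (?j, ?j) * s ?e $$ (?j, m - 1) else 0)"
        by (cases k ?j rule: linorder_cases) auto
    qed simp
    also have "\<dots> = s a $$ (?j, ?j) * s ?e $$ (?j, m - 1)" using j by simp
    finally show ?thesis .
  qed
  ultimately have "(s a $$ (?j, ?j) - a $$ (j, j)) * s ?e $$ (?j, m - 1) = 0"
    using zC s_closed[OF a] j by (auto simp: algebra_simps simp del: index_mult_mat(1))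
  thus ?thesis using z0 by simp
qed

lemma regular_skew_element:
  obtains a where "a \<in> A \<one>" "s a = - a" "\<And>i j. i < m \<Longrightarrow> j < m \<Longrightarrow> a $$ (i, i) = a $$ (j, j) \<Longrightarrow> i = j"
    "\<And>i. i < m \<Longrightarrow> a $$ (m - 1 - i, m - 1 - i) = - a $$ (i, i)"
proof -
  \<comment> \<open>These integers are distinct and change sign under reversal of the indices, so
    subtracting the reversed diagonal doubles them.\<close>
  define d :: "nat \<Rightarrow> 'a" where "d i = of_nat i - of_nat (m - 1 - i)" for i
  define D where "D = mat m m (\<lambda>(i, j). if i = j then d i else 0)"
  have D: "D \<in> C" unfolding D_def by (rule diag_closed)
  \<comment> \<open>Parts of degree other than \<open>\<one>\<close> have zero diagonal, so the part
    of degree \<open>\<one>\<close> keeps the whole diagonal.\<close>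
  have diag: "part \<one> x $$ (i, i) = x $$ (i, i)" if "x \<in> C" "i < m" for x i
    using that(1)
  proof (induction rule: homogeneous_induct_C)
    case (homogeneous g y)
    thus ?case using part_homogeneous[of g \<one> y] diag_zero[of g y i] that by auto
  next
    case (add y z)
    thus ?case using that part_add[of y z \<one>] part_C[of y \<one>] part_C[of z \<one>] by simp
  qed (use that part_zero in auto)
  define a where "a = part \<one> D - s (part \<one> D)"
  have p: "part \<one> D \<in> C" "part \<one> D \<in> A \<one>" using part_C part_A D by auto
  have a1: "a \<in> A \<one>" using p s_A A_diff by (simp add: a_def)
  have sa: "s a = - a"
    using p s_closed[OF p(1)] by (auto simp: a_def s_diff s_s carrier_UT_iff intro!: eq_matI)
  have ad: "a $$ (i, i) = 2 * d i" if "i < m" for i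
  proof -
    have "s (part \<one> D) $$ (i, i) = d (m - 1 - i)"
      using s_diag[OF p(1), of "m - 1 - i"] diag[OF D, of "m - 1 - i"] that
      by (simp add: D_def)
    moreover have "part \<one> D $$ (i, i) = d i" using diag[OF D that] that by (simp add: D_def)
    ultimately have "a $$ (i, i) = d i - d (m - 1 - i)"
      using p s_closed[OF p(1)] that by (simp add: a_def)
    also have "\<dots> = 2 * d i" using that by (simp add: d_def)
    finally show ?thesis .
  qed
  have inj: "i = j" if "i < m" "j < m" "d i = d j" for i j
  proof -
    have "of_nat i + of_nat (m - 1 - j) = (of_nat j + of_nat (m - 1 - i) :: 'a)"
      using that(3) by (simp add: d_def algebra_simps)
    hence "i + (m - 1 - j) = j + (m - 1 - i)" by (metis of_nat_add of_nat_eq_iff)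
    thus ?thesis using that(1,2) by linarith
  qed
  show ?thesis
  proof (rule that[OF a1 sa])
    show "i = j" if "i < m" "j < m" "a $$ (i, i) = a $$ (j, j)" for i j
      using that ad inj by auto
    show "a $$ (m - 1 - i, m - 1 - i) = - a $$ (i, i)" if "i < m" for i
      using that ad[of i] ad[of "m - 1 - i"] by (simp add: d_def)
  qed
qed

subsection \<open>Homogeneous matrix units\<close>

lemma nonzero_part:
  assumes "x \<in> C" "x \<noteq> 0\<^sub>m m m"
  obtains g where "g \<in> carrier G" "part g x \<noteq> 0\<^sub>m m m"
proof -
  obtain S where S: "finite S" "S \<subseteq> carrier G" "x = finsum (UT TYPE('a) m) (\<lambda>g. part g x) S"
    by (rule part_decomposition[OF assms(1)])
  have "\<exists>g\<in>S. part g x \<noteq> 0\<^sub>m m m"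
  proof (rule ccontr)
    assume "\<not> ?thesis"
    hence "finsum (UT TYPE('a) m) (\<lambda>g. part g x) S = finsum (UT TYPE('a) m) (\<lambda>g. \<zero>\<^bsub>UT TYPE('a) m\<^esub>) S"
      by (intro UT.finsum_cong') auto
    also have "\<dots> = \<zero>\<^bsub>UT TYPE('a) m\<^esub>" by (rule UT.finsum_zero)
    finally show False using S(3) assms(2) by simp
  qed
  thus ?thesis using that S(2) by blast
qed

text \<open>\<open>U\<close> diagonalizes the skew element \<open>a\<close> of degree \<open>\<one>\<close> with distinct eigenvalues. The
  transported matrix units span the simultaneous eigenspaces of the left and the right multiplication
  by \<open>a\<close>, and both the projections onto the components and the involution respect these
  eigenspaces.\<close>

lemma homogeneous_matrix_units:
  obtains U W t c where "U \<in> C" "W \<in> C" "W * U = 1\<^sub>m m" "U * W = 1\<^sub>m m"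
    "\<And>i j. i \<le> j \<Longrightarrow> j < m \<Longrightarrow> t i j \<in> carrier G"
    "\<And>i j. i \<le> j \<Longrightarrow> j < m \<Longrightarrow> U * (matrix_unit m i j * W) \<in> A (t i j)"
    "\<And>i j. i \<le> j \<Longrightarrow> j < m \<Longrightarrow> s (U * (matrix_unit m i j * W))
        = c i j \<cdot>\<^sub>m (U * (matrix_unit m (m - 1 - j) (m - 1 - i) * W))"
proof -
  obtain a where a: "a \<in> A \<one>" "s a = - a"
    "\<And>i j. i < m \<Longrightarrow> j < m \<Longrightarrow> a $$ (i, i) = a $$ (j, j) \<Longrightarrow> i = j"
    "\<And>i. i < m \<Longrightarrow> a $$ (m - 1 - i, m - 1 - i) = - a $$ (i, i)"
    using regular_skew_element by blast
  have aC: "a \<in> C" using A_C a(1) by blast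
  define D where "D = mat m m (\<lambda>(i, j). if i = j then a $$ (i, i) else 0)"
  obtain U W where U: "U \<in> C" and W: "W \<in> C" and WU: "W * U = 1\<^sub>m m" and UW: "U * W = 1\<^sub>m m"
    and Wa: "W * a = D * W"
    using UT_diagonalizable[OF aC a(3)] unfolding D_def by blast
  have D: "D \<in> C" unfolding D_def by (rule diag_closed)
  note assoc = UT_assoc[where ty="TYPE('a)" and m=m]
  have one: "1\<^sub>m m * x = x" "x * 1\<^sub>m m = x" if "x \<in> C" for x
    using that by (simp_all add: carrier_UT_iff)
  have aU: "a * U = U * D"
  proof -
    have "U * (W * a) * U = U * (D * W) * U" using Wa by simp
    hence "(U * W) * (a * U) = (U * D) * (W * U)" using U W D aC by (simp add: assoc)
    thus ?thesis using U W D aC WU UW by (simp add: one)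
  qed
  define F where "F i j = U * (matrix_unit m i j * W)" for i j
  have F: "F i j \<in> C" if "i \<le> j" for i j using that U W by (simp add: F_def matrix_unit_closed)
  have DE: "D * matrix_unit m i j = a $$ (i, i) \<cdot>\<^sub>m matrix_unit m i j"
      "matrix_unit m i j * D = a $$ (j, j) \<cdot>\<^sub>m matrix_unit m i j" if "i \<le> j" "j < m" for i j
  proof -
    have E: "matrix_unit m i j \<in> C" using that by (simp add: matrix_unit_closed)
    show "D * matrix_unit m i j = a $$ (i, i) \<cdot>\<^sub>m matrix_unit m i j"
      using E D diag_mult_left[OF E, of _ _ "\<lambda>i. a $$ (i, i)", folded D_def]
      by (intro UT_eqI[of _ "TYPE('a)" m]) (auto simp del: index_mult_mat(1))
    show "matrix_unit m i j * D = a $$ (j, j) \<cdot>\<^sub>m matrix_unit m i j"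
      using E D diag_mult_right[OF E, of _ _ "\<lambda>i. a $$ (i, i)", folded D_def]
      by (intro UT_eqI[of _ "TYPE('a)" m]) (auto simp del: index_mult_mat(1))
  qed
  have aF: "a * F i j = a $$ (i, i) \<cdot>\<^sub>m F i j" "F i j * a = a $$ (j, j) \<cdot>\<^sub>m F i j"
    if "i \<le> j" "j < m" for i j
  proof -
    have E: "matrix_unit m i j \<in> C" using that by (simp add: matrix_unit_closed)
    have "a * F i j = (a * U) * (matrix_unit m i j * W)"
      unfolding F_def using U W E aC by (simp add: assoc)
    also have "\<dots> = U * ((D * matrix_unit m i j) * W)"
      unfolding aU using U W E D by (simp add: assoc)
    finally show "a * F i j = a $$ (i, i) \<cdot>\<^sub>m F i j"
      unfolding DE[OF that] F_def using U W E by (simp add: UT_smult_mult[where ty="TYPE('a)" and m=m])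
    have "F i j * a = U * (matrix_unit m i j * (W * a))"
      unfolding F_def using U W E aC by (simp add: assoc)
    also have "\<dots> = U * ((matrix_unit m i j * D) * W)"
      unfolding Wa using U W E D by (simp add: assoc)
    finally show "F i j * a = a $$ (j, j) \<cdot>\<^sub>m F i j"
      unfolding DE[OF that] F_def using U W E by (simp add: UT_smult_mult[where ty="TYPE('a)" and m=m])
  qed
  \<comment> \<open>In coordinates, \<open>W * x * U\<close> is a joint eigenvector of left and
    right multiplication by \<open>D\<close>; the distinct diagonal entries confine it to position
    \<open>(i, j)\<close>.\<close>
  have eigen: "x = (W * x * U) $$ (i, j) \<cdot>\<^sub>m F i j"
    if x: "x \<in> C" "a * x = a $$ (i, i) \<cdot>\<^sub>m x" "x * a = a $$ (j, j) \<cdot>\<^sub>m x"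
      and ij: "i \<le> j" "j < m" for x i j
  proof -
    define y where "y = W * x * U"
    have y: "y \<in> C" using x U W by (simp add: y_def)
    have E: "matrix_unit m i j \<in> C" using ij by (simp add: matrix_unit_closed)
    have "D * y = (W * a) * (x * U)" unfolding Wa y_def using D W U x by (simp add: assoc)
    also have "\<dots> = W * (a * x) * U" using aC W U x(1) by (simp add: assoc)
    also have "\<dots> = a $$ (i, i) \<cdot>\<^sub>m y"
      unfolding x(2) y_def using W U x(1) by (simp add: UT_smult_mult[where ty="TYPE('a)" and m=m])
    finally have Dy: "D * y = a $$ (i, i) \<cdot>\<^sub>m y" .
    have "y * D = W * x * (U * D)" unfolding y_def using D W U x(1) by (simp add: assoc)
    also have "\<dots> = W * (x * a) * U" unfolding aU[symmetric] using aC W U x(1) by (simp add: assoc)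
    also have "\<dots> = a $$ (j, j) \<cdot>\<^sub>m y"
      unfolding x(3) y_def using W U x(1) by (simp add: UT_smult_mult[where ty="TYPE('a)" and m=m])
    finally have yD: "y * D = a $$ (j, j) \<cdot>\<^sub>m y" .
    have yE: "y = y $$ (i, j) \<cdot>\<^sub>m matrix_unit m i j"
    proof (rule UT_eqI[OF y UT_closed(3)[OF E E]])
      fix k l assume kl: "k \<le> l" "l < m"
      have "a $$ (k, k) * y $$ (k, l) = a $$ (i, i) * y $$ (k, l)"
        using diag_mult_left[OF y, of k l "\<lambda>i. a $$ (i, i)", folded D_def] Dy y kl by auto
      hence k: "y $$ (k, l) = 0 \<or> a $$ (k, k) = a $$ (i, i)" by (auto simp only: mult_cancel_right)
      have "a $$ (l, l) * y $$ (k, l) = a $$ (j, j) * y $$ (k, l)"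
        using diag_mult_right[OF y, of k l "\<lambda>i. a $$ (i, i)", folded D_def] yD y kl by (auto simp: mult.commute)
      hence l: "y $$ (k, l) = 0 \<or> a $$ (l, l) = a $$ (j, j)" by (auto simp only: mult_cancel_right)
      have "k < m" "i < m" using kl ij by auto
      hence "y $$ (k, l) = 0 \<or> k = i \<and> l = j"
        using k l a(3)[of k i] a(3)[of l j] kl(2) ij(2) by blast
      thus "y $$ (k, l) = (y $$ (i, j) \<cdot>\<^sub>m matrix_unit m i j) $$ (k, l)"
        using kl ij E by auto
    qed
    have "U * (y * W) = U * ((y $$ (i, j) \<cdot>\<^sub>m matrix_unit m i j) * W)"
      by (rule arg_cong[OF yE, of "\<lambda>z. U * (z * W)"])
    also have "\<dots> = y $$ (i, j) \<cdot>\<^sub>m F i j"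
      unfolding F_def using U W E by (simp add: UT_smult_mult[where ty="TYPE('a)" and m=m])
    also have "U * (y * W) = (U * W) * x * (U * W)"
      unfolding y_def using U W x(1) by (simp add: assoc)
    also have "\<dots> = x" unfolding UW using x(1) by (simp add: one)
    finally show ?thesis unfolding y_def .
  qed
  have F_nonzero: "F i j \<noteq> 0\<^sub>m m m" if "i \<le> j" "j < m" for i j
  proof
    assume "F i j = 0\<^sub>m m m"
    have E: "matrix_unit m i j \<in> C" using that by (simp add: matrix_unit_closed)
    have "W * F i j * U = (W * U) * matrix_unit m i j * (W * U)"
      unfolding F_def using U W E by (simp add: assoc)
    hence "matrix_unit m i j = W * 0\<^sub>m m m * U"
      unfolding \<open>F i j = 0\<^sub>m m m\<close> WU using E by (simp add: one)
    also have "\<dots> = 0\<^sub>m m m" using U W by (simp add: carrier_UT_iff)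
    finally have "matrix_unit m i j $$ (i, j) = (0 :: 'a)" using that by simp
    thus False using that by simp
  qed
  \<comment> \<open>Multiplication by \<open>a\<close> preserves degrees, so a nonzero part of
    \<open>F i j\<close> lies in the same one-dimensional eigenspace and is a nonzero multiple of
    \<open>F i j\<close>.\<close>
  have hom: "\<exists>g. g \<in> carrier G \<and> F i j \<in> A g" if ij: "i \<le> j" "j < m" for i j
  proof -
    obtain g where g: "g \<in> carrier G" "part g (F i j) \<noteq> 0\<^sub>m m m"
      using nonzero_part[OF F[OF ij(1)] F_nonzero[OF ij]] .
    define p where "p = part g (F i j)"
    have p: "p \<in> C" "p \<in> A g" using part_C part_A F g ij by (simp_all add: p_def)
    have "a * p = a $$ (i, i) \<cdot>\<^sub>m p" "p * a = a $$ (j, j) \<cdot>\<^sub>m p"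
      using part_mult_left[OF one_closed g(1) a(1) F[OF ij(1)]]
        part_mult_right[OF one_closed g(1) a(1) F[OF ij(1)]] g F[OF ij(1)]
      by (simp_all add: aF[OF ij] part_smult p_def)
    from eigen[OF p(1) this ij] obtain k where k: "p = k \<cdot>\<^sub>m F i j" by blast
    have "k \<noteq> 0"
    proof
      assume "k = 0"
      hence "p = 0\<^sub>m m m" unfolding k using F[OF ij(1)] by (intro eq_matI) auto
      thus False using g(2) by (simp add: p_def)
    qed
    hence "F i j = inverse k \<cdot>\<^sub>m p" unfolding k using F[OF ij(1)] by (intro eq_matI) auto
    thus ?thesis using A_smult[OF g(1) p(2)] g(1) by auto
  qed
  \<comment> \<open>The involution exchanges left and right multiplication and negates
    \<open>a\<close>; negating a diagonal entry of \<open>a\<close> reflects its index.\<close>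
  have sF: "\<exists>k. s (F i j) = k \<cdot>\<^sub>m F (m - 1 - j) (m - 1 - i)" if ij: "i \<le> j" "j < m" for i j
  proof -
    have neg: "x * (- a) = - (x * a)" "(- a) * x = - (a * x)" if "x \<in> C" for x
      using that aC uminus_mult_right_mat[of x a] uminus_mult_left_mat[of a x] by auto
    have neg2: "- (- x) = x" "- (k \<cdot>\<^sub>m x) = (- k) \<cdot>\<^sub>m x" if "x \<in> C" for x :: "'a mat" and k
      using that by (auto intro!: eq_matI)
    have FC: "F i j \<in> C" "s (F i j) \<in> C" using F ij by auto
    have "- (a * s (F i j)) = s (F i j * a)" using FC aC a(2) neg by (simp add: s_mult)
    also have "\<dots> = a $$ (j, j) \<cdot>\<^sub>m s (F i j)" unfolding aF[OF ij] using FC by (simp add: s_smult)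
    finally have "a * s (F i j) = - (a $$ (j, j) \<cdot>\<^sub>m s (F i j))"
      using neg2(1)[of "a * s (F i j)"] aC FC by simp
    hence l: "a * s (F i j) = a $$ (m - 1 - j, m - 1 - j) \<cdot>\<^sub>m s (F i j)"
      using a(4)[of j] ij neg2(2) FC by simp
    have "- (s (F i j) * a) = s (a * F i j)" using FC aC a(2) neg by (simp add: s_mult)
    also have "\<dots> = a $$ (i, i) \<cdot>\<^sub>m s (F i j)" unfolding aF[OF ij] using FC by (simp add: s_smult)
    finally have "s (F i j) * a = - (a $$ (i, i) \<cdot>\<^sub>m s (F i j))"
      using neg2(1)[of "s (F i j) * a"] aC FC by simp
    hence r: "s (F i j) * a = a $$ (m - 1 - i, m - 1 - i) \<cdot>\<^sub>m s (F i j)"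
      using a(4)[of i] ij neg2(2) FC by simp
    have "m - 1 - j \<le> m - 1 - i" "m - 1 - i < m" using ij by auto
    from eigen[OF FC(2) l r this] show ?thesis by blast
  qed
  show ?thesis
  proof (rule that[OF U W WU UW])
    fix i j assume ij: "i \<le> j" "j < m"
    show "(SOME g. g \<in> carrier G \<and> F i j \<in> A g) \<in> carrier G"
      using someI_ex[OF hom[OF ij]] by blast
    show "U * (matrix_unit m i j * W) \<in> A (SOME g. g \<in> carrier G \<and> F i j \<in> A g)"
      using someI_ex[OF hom[OF ij]] by (simp add: F_def)
    show "s (U * (matrix_unit m i j * W))
        = (SOME k. s (F i j) = k \<cdot>\<^sub>m F (m - 1 - j) (m - 1 - i)) \<cdot>\<^sub>m
          (U * (matrix_unit m (m - 1 - j) (m - 1 - i) * W))"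
      using someI_ex[OF sF[OF ij]] by (simp add: F_def)
  qed
qed

end

section \<open>Degrees and involution coefficients of the homogeneous basis\<close>

lemma smult_smult_mat: "a \<cdot>\<^sub>m (b \<cdot>\<^sub>m (X :: 'a :: field mat)) = (a * b) \<cdot>\<^sub>m X"
  by (intro eq_matI) auto

locale graded_UT_basis = graded_UT G m A s
  for G :: "('g, 'c) monoid_scheme" (structure) and m
    and A :: "'g \<Rightarrow> 'a :: field_char_0 mat set" and s +
  fixes U W :: "'a mat" and t :: "nat \<Rightarrow> nat \<Rightarrow> 'g" and c :: "nat \<Rightarrow> nat \<Rightarrow> 'a"
  assumes U: "U \<in> C" and W: "W \<in> C" and WU: "W * U = 1\<^sub>m m" and UW: "U * W = 1\<^sub>m m"
    and t_closed: "\<And>i j. i \<le> j \<Longrightarrow> j < m \<Longrightarrow> t i j \<in> carrier G"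
    and unit_A: "\<And>i j. i \<le> j \<Longrightarrow> j < m \<Longrightarrow> U * (matrix_unit m i j * W) \<in> A (t i j)"
    and s_unit: "\<And>i j. i \<le> j \<Longrightarrow> j < m \<Longrightarrow> s (U * (matrix_unit m i j * W))
        = c i j \<cdot>\<^sub>m (U * (matrix_unit m (m - 1 - j) (m - 1 - i) * W))"
begin

definition F :: "nat \<Rightarrow> nat \<Rightarrow> 'a mat" where "F i j = U * (matrix_unit m i j * W)"

text \<open>The entry at \<open>(i, j)\<close> is the coefficient of \<open>F i j\<close> in
  \<open>x\<close>.\<close>

abbreviation coord :: "'a mat \<Rightarrow> 'a mat" where "coord x \<equiv> W * x * U"

lemma F_C: "i \<le> j \<Longrightarrow> F i j \<in> C"
  using U W by (simp add: F_def matrix_unit_closed)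

lemma F_A: "i \<le> j \<Longrightarrow> j < m \<Longrightarrow> F i j \<in> A (t i j)"
  using unit_A by (simp add: F_def)

lemma s_F: "i \<le> j \<Longrightarrow> j < m \<Longrightarrow> s (F i j) = c i j \<cdot>\<^sub>m F (m - 1 - j) (m - 1 - i)"
  using s_unit by (simp add: F_def)

lemma C_one: "x \<in> C \<Longrightarrow> 1\<^sub>m m * x = x" "x \<in> C \<Longrightarrow> x * 1\<^sub>m m = x"
  by (simp_all add: carrier_UT_iff)

lemma coord_C: "x \<in> C \<Longrightarrow> coord x \<in> C"
  using U W by simp

lemma coord_F:
  assumes "i \<le> j"
  shows "coord (F i j) = matrix_unit m i j"
proof -
  have E: "matrix_unit m i j \<in> C" using assms by (simp add: matrix_unit_closed)
  have "coord (F i j) = (W * U) * matrix_unit m i j * (W * U)"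
    unfolding F_def using U W E by (simp add: UT_assoc[where ty="TYPE('a)" and m=m])
  thus ?thesis using E by (simp add: WU C_one)
qed

lemma coord_mult: "x \<in> C \<Longrightarrow> y \<in> C \<Longrightarrow> coord (x * y) = coord x * coord y"
proof -
  assume xy: "x \<in> C" "y \<in> C"
  have "coord x * coord y = W * x * ((U * W) * y) * U"
    using U W xy by (simp add: UT_assoc[where ty="TYPE('a)" and m=m])
  thus ?thesis using U W xy by (simp add: UW C_one UT_assoc[where ty="TYPE('a)" and m=m])
qed

lemma coord_smult: "x \<in> C \<Longrightarrow> coord (k \<cdot>\<^sub>m x) = k \<cdot>\<^sub>m coord x"
  using U W by (simp add: UT_smult_mult[where ty="TYPE('a)" and m=m])

lemma coord_inject:
  assumes "x \<in> C" "y \<in> C" "coord x = coord y"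
  shows "x = y"
proof -
  have "U * (coord z * W) = z" if "z \<in> C" for z
  proof -
    have "U * (coord z * W) = (U * W) * z * (U * W)"
      using U W that by (simp add: UT_assoc[where ty="TYPE('a)" and m=m])
    thus ?thesis using that by (simp add: UW C_one)
  qed
  thus ?thesis using assms by metis
qed

lemma F_mult:
  assumes "i \<le> j" "j \<le> k" "k < m"
  shows "F i j * F j k = F i k"
  by (rule coord_inject) (use assms in \<open>simp_all add: F_C coord_mult coord_F matrix_unit_mult\<close>)

lemma F_nonzero:
  assumes "i \<le> j" "j < m"
  shows "F i j \<noteq> 0\<^sub>m m m"
proof
  assume "F i j = 0\<^sub>m m m"
  hence "matrix_unit m i j = coord (0\<^sub>m m m)" using coord_F[OF assms(1)] by simp
  also have "\<dots> = 0\<^sub>m m m" using U W by (simp add: carrier_UT_iff)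
  finally have "matrix_unit m i j $$ (i, j) = (0 :: 'a)" using assms by simp
  thus False using assms by simp
qed

text \<open>Multiplying by the idempotents \<open>F i i\<close> and \<open>F j j\<close> extracts
  one coordinate. In this form it can be traced through degrees and through
  \<open>s\<close>.\<close>

lemma F_sandwich:
  assumes x: "x \<in> C" and ij: "i \<le> j" "j < m"
  shows "F i i * x * F j j = coord x $$ (i, j) \<cdot>\<^sub>m F i j"
proof (rule coord_inject)
  have E: "matrix_unit m i i \<in> C" "matrix_unit m j j \<in> C" by (simp_all add: matrix_unit_closed)
  have "coord (F i i * x * F j j) = matrix_unit m i i * coord x * matrix_unit m j j"
    using x ij F_C by (simp add: coord_mult coord_F)
  also have "\<dots> = coord x $$ (i, j) \<cdot>\<^sub>m matrix_unit m i j"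
  proof (rule UT_eqI[where ty="TYPE('a)" and m=m])
    fix k l assume kl: "k \<le> l" "l < m"
    hence "(matrix_unit m i i * coord x * matrix_unit m j j) $$ (k, l)
        = (if l = j then (matrix_unit m i i * coord x) $$ (k, j) else 0)"
      using matrix_unit_mult_right[OF UT_closed(5)[OF E(1) coord_C[OF x]] le_refl ij(2), of k l] ij by simp
    also have "\<dots> = (if l = j \<and> k = i then coord x $$ (i, j) else 0)"
      using matrix_unit_mult_left[OF coord_C[OF x] le_refl, of i k j] ij kl by (auto simp del: index_mult_mat(1))
    finally show "(matrix_unit m i i * coord x * matrix_unit m j j) $$ (k, l)
        = (coord x $$ (i, j) \<cdot>\<^sub>m matrix_unit m i j) $$ (k, l)"
      using ij kl matrix_unit_closed[OF ij(1), of m "TYPE('a)"] by auto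
  qed (use E coord_C[OF x] matrix_unit_closed[OF ij(1)] in \<open>auto intro!: UT_closed\<close>)
  also have "\<dots> = coord (coord x $$ (i, j) \<cdot>\<^sub>m F i j)"
    using ij F_C by (simp add: coord_smult coord_F)
  finally show "coord (F i i * x * F j j) = coord (coord x $$ (i, j) \<cdot>\<^sub>m F i j)" .
qed (use x ij F_C in auto)

lemma t_mult:
  assumes "i \<le> j" "j \<le> k" "k < m"
  shows "t i j \<otimes> t j k = t i k"
proof (rule degree_unique)
  show "F i k \<in> A (t i j \<otimes> t j k)"
    using A_mult[of "t i j" "t j k" "F i j" "F j k"] assms t_closed F_A F_mult by simp
qed (use assms t_closed F_A F_nonzero in auto)

lemma t_diag: "i < m \<Longrightarrow> t i i = \<one>"
  using t_mult[of i i i] t_closed[of i i] by simp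

lemma smult_nonzero_A:
  assumes "g \<in> carrier G" "k \<cdot>\<^sub>m F i j \<in> A g" "k \<noteq> 0" "i \<le> j" "j < m"
  shows "t i j = g"
proof -
  have "F i j = inverse k \<cdot>\<^sub>m (k \<cdot>\<^sub>m F i j)"
    using assms(3) F_C[OF assms(4)] by (intro eq_matI) auto
  hence "F i j \<in> A g" using A_smult[OF assms(1,2)] by metis
  thus ?thesis using degree_unique[of "t i j" g "F i j"] assms t_closed F_A F_nonzero by auto
qed

lemma c_nonzero:
  assumes "i \<le> j" "j < m"
  shows "c i j \<noteq> 0"
proof
  assume "c i j = 0"
  hence "s (F i j) = 0\<^sub>m m m"
    unfolding s_F[OF assms] using F_C[of "m - 1 - j" "m - 1 - i"] assms by (intro eq_matI) auto
  thus False using s_eq_zero[of "F i j"] F_C F_nonzero assms by blast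
qed

lemma t_reflect:
  assumes "i \<le> j" "j < m"
  shows "t (m - 1 - j) (m - 1 - i) = t i j"
proof (rule smult_nonzero_A)
  show "c i j \<cdot>\<^sub>m F (m - 1 - j) (m - 1 - i) \<in> A (t i j)"
    using s_A[OF t_closed F_A] s_F assms by metis
qed (use assms t_closed c_nonzero in auto)

lemma t_commute:
  assumes "i \<le> j" "j \<le> k" "k < m"
  shows "t i j \<otimes> t j k = t j k \<otimes> t i j"
proof (rule degrees_commute)
  show "F i j \<in> A (t i j)" "F j k \<in> A (t j k)" using assms F_A by auto
  show "F i j * F j k \<noteq> 0\<^sub>m m m" using F_mult[OF assms] F_nonzero[of i k] assms by simp
qed (use assms t_closed in auto)

text \<open>The idempotents have degree \<open>\<one>\<close>, so the sandwich of \<open>x\<close>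
  between them still has degree \<open>g\<close>, while it is a nonzero multiple of
  \<open>F i j\<close>.\<close>

lemma coord_support:
  assumes g: "g \<in> carrier G" and x: "x \<in> A g" and ij: "i \<le> j" "j < m"
    and nz: "coord x $$ (i, j) \<noteq> 0"
  shows "t i j = g"
proof (rule smult_nonzero_A[OF g _ nz ij])
  have "F i i \<in> A \<one>" "F j j \<in> A \<one>" using F_A[of i i] F_A[of j j] t_diag ij by auto
  hence "F i i * x * F j j \<in> A (\<one> \<otimes> g \<otimes> \<one>)" using g x by (intro A_mult) auto
  thus "coord x $$ (i, j) \<cdot>\<^sub>m F i j \<in> A g" using F_sandwich[of x i j] A_C[OF g x] g ij by simp
qed

lemma smult_F_inject:
  assumes "k \<cdot>\<^sub>m F i j = l \<cdot>\<^sub>m F i j" "i \<le> j" "j < m"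
  shows "k = l"
proof -
  have "k \<cdot>\<^sub>m matrix_unit m i j = (l \<cdot>\<^sub>m matrix_unit m i j :: 'a mat)"
    using arg_cong[OF assms(1), of coord] F_C[OF assms(2)] assms(2) by (simp add: coord_smult coord_F)
  from arg_cong[OF this, of "\<lambda>x. x $$ (i, j)"] show ?thesis
    using assms matrix_unit_closed[OF assms(2), of m "TYPE('a)"] by simp
qed

text \<open>\<open>s\<close> reverses products and the reflection reverses chains of indices; the
  two reversals cancel, which makes \<open>c\<close> multiplicative.\<close>

lemma c_mult:
  assumes "i \<le> j" "j \<le> k" "k < m"
  shows "c i j * c j k = c i k"
proof (rule smult_F_inject)
  have refl: "m - 1 - k \<le> m - 1 - j" "m - 1 - j \<le> m - 1 - i" "m - 1 - i < m" using assms by auto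
  have "c i k \<cdot>\<^sub>m F (m - 1 - k) (m - 1 - i) = s (F i j * F j k)"
    using F_mult[OF assms] s_F[of i k] assms by simp
  also have "\<dots> = s (F j k) * s (F i j)" using F_C assms by (simp add: s_mult)
  also have "\<dots> = (c j k \<cdot>\<^sub>m F (m - 1 - k) (m - 1 - j)) * (c i j \<cdot>\<^sub>m F (m - 1 - j) (m - 1 - i))"
    using s_F[of j k] s_F[of i j] assms by simp
  also have "\<dots> = c j k \<cdot>\<^sub>m (c i j \<cdot>\<^sub>m F (m - 1 - k) (m - 1 - i))"
    using F_C[OF refl(1)] F_C[OF refl(2)] F_mult[OF refl]
    by (simp add: UT_smult_mult[where ty="TYPE('a)" and m=m] smult_smult_mat mult.commute)
  finally show "(c i j * c j k) \<cdot>\<^sub>m F (m - 1 - k) (m - 1 - i)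
      = c i k \<cdot>\<^sub>m F (m - 1 - k) (m - 1 - i)"
    by (simp add: smult_smult_mat mult.commute)
qed (use assms in auto)

lemma c_diag: "i < m \<Longrightarrow> c i i = 1"
  using c_mult[of i i i] c_nonzero[of i i] by simp

lemma c_reflect:
  assumes "i \<le> j" "j < m"
  shows "c i j * c (m - 1 - j) (m - 1 - i) = 1"
proof (rule smult_F_inject[OF _ assms])
  have r: "m - 1 - j \<le> m - 1 - i" "m - 1 - i < m" using assms by auto
  have "F i j = s (s (F i j))" using s_s F_C assms by simp
  also have "\<dots> = c i j \<cdot>\<^sub>m s (F (m - 1 - j) (m - 1 - i))"
    using s_F[OF assms] s_smult[OF F_C[OF r(1)]] by simp
  also have "\<dots> = c i j \<cdot>\<^sub>m (c (m - 1 - j) (m - 1 - i) \<cdot>\<^sub>m F i j)"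
    using s_F[OF r] assms by simp
  finally have "F i j = (c i j * c (m - 1 - j) (m - 1 - i)) \<cdot>\<^sub>m F i j"
    by (simp add: smult_smult_mat)
  moreover have "1 \<cdot>\<^sub>m F i j = F i j" by (intro eq_matI) auto
  ultimately show "(c i j * c (m - 1 - j) (m - 1 - i)) \<cdot>\<^sub>m F i j = 1 \<cdot>\<^sub>m F i j" by simp
qed

text \<open>\<open>s\<close> maps each idempotent to the reflected one with coefficient
  \<open>1\<close>, hence sandwiches to sandwiches.\<close>

lemma coord_s:
  assumes x: "x \<in> C" and ij: "i \<le> j" "j < m"
  shows "coord (s x) $$ (m - 1 - j, m - 1 - i) = c i j * coord x $$ (i, j)"
proof (rule smult_F_inject)
  let ?i = "m - 1 - i" and ?j = "m - 1 - j"
  have "coord (s x) $$ (?j, ?i) \<cdot>\<^sub>m F ?j ?i = F ?j ?j * s x * F ?i ?i"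
    using F_sandwich[OF s_closed[OF x], of ?j ?i] ij by simp
  also have "\<dots> = s (F j j) * s x * s (F i i)"
  proof -
    have "1 \<cdot>\<^sub>m F k l = F k l" for k l by (intro eq_matI) auto
    thus ?thesis using s_F[of j j] s_F[of i i] c_diag ij by simp
  qed
  also have "\<dots> = s (F i i * x * F j j)"
    using x F_C by (simp add: s_mult UT_assoc[where ty="TYPE('a)" and m=m])
  also have "\<dots> = coord x $$ (i, j) \<cdot>\<^sub>m (c i j \<cdot>\<^sub>m F ?j ?i)"
    using F_sandwich[OF x ij] F_C ij s_F[OF ij] by (simp add: s_smult)
  finally show "coord (s x) $$ (?j, ?i) \<cdot>\<^sub>m F ?j ?i = (c i j * coord x $$ (i, j)) \<cdot>\<^sub>m F ?j ?i"
    by (simp add: smult_smult_mat mult.commute)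
qed (use ij in auto)

end

section \<open>Degrees\<close>

text \<open>The order of the factors is fixed because \<open>G\<close> need not be commutative; the
  product is a homomorphism in \<open>z\<close> once the \<open>t i\<close> commute.\<close>

primrec pow_product ::
  "('g, 'c) monoid_scheme \<Rightarrow> (nat \<Rightarrow> 'g) \<Rightarrow> nat \<Rightarrow> (nat \<Rightarrow> int) \<Rightarrow> 'g" where
  "pow_product G t 0 z = \<one>\<^bsub>G\<^esub>"
| "pow_product G t (Suc n) z = pow_product G t n z \<otimes>\<^bsub>G\<^esub> (t n [^]\<^bsub>G\<^esub> z n)"

context group
begin

lemma commute_inv:
  assumes "x \<in> carrier G" "y \<in> carrier G" "x \<otimes> y = y \<otimes> x"
  shows "x \<otimes> inv y = inv y \<otimes> x"
proof -
  have "x \<otimes> inv y = inv y \<otimes> (y \<otimes> x) \<otimes> inv y"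
    using assms(1,2) by (simp add: m_assoc[symmetric])
  also have "\<dots> = inv y \<otimes> x"
    using assms by (simp add: assms(3)[symmetric] m_assoc)
  finally show ?thesis .
qed

lemma commute_int_pow:
  assumes "x \<in> carrier G" "y \<in> carrier G" "x \<otimes> y = y \<otimes> x"
  shows "x \<otimes> (y [^] (k :: int)) = (y [^] k) \<otimes> x"
proof -
  have nat: "x \<otimes> (y [^] (n :: nat)) = (y [^] n) \<otimes> x" for n
    using group_commutes_pow[of y x n] assms by simp
  show ?thesis
  proof (cases k)
    case (nonneg n)
    thus ?thesis using nat by (simp add: int_pow_int)
  next
    case (neg n)
    have "x \<otimes> inv (y [^] Suc n) = inv (y [^] Suc n) \<otimes> x"
      using assms(1,2) by (intro commute_inv nat) auto
    thus ?thesis unfolding neg int_pow_neg_int[OF assms(2)] .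
  qed
qed

lemma pow_product_closed:
  "(\<And>i. i < n \<Longrightarrow> t i \<in> carrier G) \<Longrightarrow> pow_product G t n z \<in> carrier G"
  by (induction n) auto

lemma commute_pow_product:
  assumes "x \<in> carrier G" "\<And>i. i < n \<Longrightarrow> t i \<in> carrier G" "\<And>i. i < n \<Longrightarrow> x \<otimes> t i = t i \<otimes> x"
  shows "x \<otimes> pow_product G t n z = pow_product G t n z \<otimes> x"
  using assms
proof (induction n)
  case (Suc n)
  have c: "pow_product G t n z \<in> carrier G" "t n [^] z n \<in> carrier G"
    using Suc.prems pow_product_closed[of n t z] by auto
  have "x \<otimes> pow_product G t (Suc n) z = (x \<otimes> pow_product G t n z) \<otimes> (t n [^] z n)"
    using c Suc.prems by (simp add: m_assoc)
  also have "x \<otimes> pow_product G t n z = pow_product G t n z \<otimes> x" using Suc by simp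
  also have "pow_product G t n z \<otimes> x \<otimes> (t n [^] z n) = pow_product G t n z \<otimes> (x \<otimes> (t n [^] z n))"
    using c Suc.prems by (simp add: m_assoc)
  also have "x \<otimes> (t n [^] z n) = (t n [^] z n) \<otimes> x"
    using Suc.prems by (intro commute_int_pow) auto
  finally show ?case using c Suc.prems by (simp add: m_assoc)
qed simp

text \<open>Commuting \<open>t i\<close> let the last factor for \<open>z\<close> pass the whole
  product for \<open>w\<close>. Exponents are compared only below \<open>n\<close>, which suits the
  restricted functions in \<open>Z_pow\<close>.\<close>

lemma pow_product_add:
  assumes "\<And>i. i < n \<Longrightarrow> t i \<in> carrier G"
    "\<And>i j. i < n \<Longrightarrow> j < n \<Longrightarrow> t i \<otimes> t j = t j \<otimes> t i"
    "\<And>i. i < n \<Longrightarrow> u i = z i + w i"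
  shows "pow_product G t n u = pow_product G t n z \<otimes> pow_product G t n w"
  using assms
proof (induction n)
  case (Suc n)
  let ?p = "pow_product G t n"
  have c: "?p z \<in> carrier G" "?p w \<in> carrier G" "t n \<in> carrier G"
    using Suc.prems pow_product_closed[of n t] by auto
  have comm: "(t n [^] z n) \<otimes> ?p w = ?p w \<otimes> (t n [^] z n)"
  proof (rule commute_int_pow[symmetric])
    show "?p w \<otimes> t n = t n \<otimes> ?p w"
      using Suc.prems by (intro commute_pow_product[symmetric]) auto
  qed (use c in auto)
  have "pow_product G t (Suc n) u = ?p z \<otimes> ?p w \<otimes> ((t n [^] z n) \<otimes> (t n [^] w n))"
    using Suc c by (simp add: int_pow_mult)
  also have "\<dots> = ?p z \<otimes> (?p w \<otimes> (t n [^] z n)) \<otimes> (t n [^] w n)"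
    using c by (simp add: m_assoc)
  also have "\<dots> = ?p z \<otimes> (t n [^] z n) \<otimes> (?p w \<otimes> (t n [^] w n))"
    unfolding comm[symmetric] using c by (simp add: m_assoc)
  finally show ?case by simp
qed simp

lemma pow_product_hom:
  assumes "\<And>i. i < r \<Longrightarrow> t i \<in> carrier G"
    "\<And>i j. i < r \<Longrightarrow> j < r \<Longrightarrow> t i \<otimes> t j = t j \<otimes> t i"
  shows "pow_product G t r \<in> hom (Z_pow r) G"
proof (rule homI)
  show "pow_product G t r (z \<otimes>\<^bsub>Z_pow r\<^esub> w) = pow_product G t r z \<otimes> pow_product G t r w" for z w
    using assms by (intro pow_product_add) (auto simp: Z_pow_def)
qed (use assms pow_product_closed in auto)

lemma pow_product_std_vec:
  assumes "\<And>i. i < n \<Longrightarrow> t i \<in> carrier G" "n \<le> r"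
  shows "pow_product G t n (std_vec r i) = (if i < n then t i else \<one>)"
  using assms
proof (induction n)
  case (Suc n)
  thus ?case by (cases "i < n"; cases "i = n") (auto simp: std_vec_def)
qed simp

end

lemma group_Z_pow: "group (Z_pow r)"
  by (simp add: Z_pow_def)

lemma std_vec_closed: "std_vec r i \<in> carrier (Z_pow r)"
  by (simp add: Z_pow_def std_vec_def)

lemma finest_tuple_closed: "finest_tuple m i \<in> carrier (Z_pow (m div 2))"
proof -
  interpret Z: group "Z_pow (m div 2)" by (rule group_Z_pow)
  show ?thesis
    unfolding finest_tuple_def Let_def
    using std_vec_closed[of "m div 2"] by (auto simp del: one_product_group)
qed

definition finest_degree :: "nat \<Rightarrow> nat \<Rightarrow> nat \<Rightarrow> nat \<Rightarrow> int" where
  "finest_degree m i j =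
     finest_tuple m i \<otimes>\<^bsub>Z_pow (m div 2)\<^esub> inv\<^bsub>Z_pow (m div 2)\<^esub> finest_tuple m j"

lemma finest_degree_closed: "finest_degree m i j \<in> carrier (Z_pow (m div 2))"
proof -
  interpret Z: group "Z_pow (m div 2)" by (rule group_Z_pow)
  show ?thesis unfolding finest_degree_def using finest_tuple_closed by simp
qed

context graded_UT_basis
begin

text \<open>The value of the homomorphism on the \<open>i\<close>-th basis vector is forced, because the entry of
  \<open>finest_tuple\<close> with index \<open>m div 2\<close> is zero.\<close>

lemma degree_hom:
  assumes "0 < m"
  obtains \<alpha> where "\<alpha> \<in> hom (Z_pow (m div 2)) G"
    "\<And>i j. i \<le> j \<Longrightarrow> j < m \<Longrightarrow> \<alpha> (finest_degree m i j) = t i j"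
proof -
  define r where "r = m div 2"
  have r: "r < m" using assms by (simp add: r_def)
  define \<alpha> where "\<alpha> = pow_product G (\<lambda>i. t i r) r"
  have tc: "t i r \<in> carrier G" if "i < r" for i using that r t_closed by simp
  \<comment> \<open>\<open>t i r\<close> is \<open>t i j \<otimes> t j r\<close>, and these two
    factors commute because \<open>F i j * F j r\<close> is nonzero.\<close>
  have comm: "t i r \<otimes> t j r = t j r \<otimes> t i r" if "i < j" "j < r" for i j
  proof -
    have c: "t i j \<in> carrier G" "t j r \<in> carrier G" using that r t_closed by simp_all
    have ir: "t i r = t i j \<otimes> t j r" using t_mult[of i j r] that r by simp
    have "t i j \<otimes> t j r = t j r \<otimes> t i j" using t_commute[of i j r] that r by simp
    thus ?thesis unfolding ir using c by (metis m_assoc)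
  qed
  have comm': "t i r \<otimes> t j r = t j r \<otimes> t i r" if "i < r" "j < r" for i j
    using comm[of i j] comm[of j i] that by (cases i j rule: linorder_cases) auto
  have hom: "\<alpha> \<in> hom (Z_pow r) G"
    unfolding \<alpha>_def using tc comm' by (rule pow_product_hom)
  interpret \<alpha>: group_hom "Z_pow r" G \<alpha>
    using hom group_Z_pow is_group by (simp add: group_hom_def group_hom_axioms_def)
  have e: "\<alpha> (std_vec r i) = t i r" if "i < r" for i
    unfolding \<alpha>_def using pow_product_std_vec[of r "\<lambda>i. t i r" r i] tc that by simp
  have lower: "\<alpha> (finest_tuple m i) = t i r" if "i \<le> r" for i
    using that e[of i] t_diag[of r] r \<alpha>.hom_one
    by (cases "i = r") (auto simp: finest_tuple_def Let_def r_def simp del: one_product_group)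
  have upper: "\<alpha> (finest_tuple m i) = inv (t r i)" if i: "r < i" "i < m" for i
  \<comment> \<open>The reflection fixes \<open>r\<close> for odd \<open>m\<close> and sends it to
    \<open>r - 1\<close> for even \<open>m\<close>; this explains the additional
    \<open>e (r - 1)\<close> in the even \<open>finest_tuple\<close>.\<close>
  proof (cases "even m")
    case False
    hence m: "m = 2 * r + 1" by (auto simp: r_def)
    have "\<alpha> (finest_tuple m i) = inv (t (m - 1 - i) r)"
      using False i e[of "m - 1 - i"] m \<alpha>.hom_inv[OF std_vec_closed]
      by (simp add: finest_tuple_def Let_def r_def[symmetric])
    also have "t (m - 1 - i) r = t r i"
      using t_reflect[of r i] i m by simp
    finally show ?thesis .
  next
    case True
    hence m: "m = 2 * r" by (auto simp: r_def)
    have "\<alpha> (finest_tuple m i) = t (r - 1) r \<otimes> inv (t (m - 1 - i) r)"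
      using True i e[of "m - 1 - i"] e[of "r - 1"] m \<alpha>.hom_inv[OF std_vec_closed]
        \<alpha>.hom_mult[OF std_vec_closed group.inv_closed[OF group_Z_pow std_vec_closed]]
      by (simp add: finest_tuple_def Let_def r_def[symmetric])
    also have "t (m - 1 - i) r = t (r - 1) i"
      using t_reflect[of "r - 1" i] i m by simp
    also have "\<dots> = t (r - 1) r \<otimes> t r i"
      using t_mult[of "r - 1" r i] i by simp
    also have "\<dots> = t r i \<otimes> t (r - 1) r"
      using t_commute[of "r - 1" r i] i by simp
    finally show ?thesis
      using t_closed[of "r - 1" r] t_closed[of r i] i r by (simp add: inv_mult_group m_assoc[symmetric])
  qed
  have "\<alpha> (finest_degree m i j) = t i j" if ij: "i \<le> j" "j < m" for i j
  proof -
    have "\<alpha> (finest_degree m i j) = \<alpha> (finest_tuple m i) \<otimes> inv (\<alpha> (finest_tuple m j))"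
      unfolding finest_degree_def r_def[symmetric]
      using finest_tuple_closed[of m, folded r_def] by simp
    also have "\<dots> = t i j"
    proof -
      \<comment> \<open>The tuple records degrees relative to the base index \<open>r\<close>, so
        \<open>t_mult\<close> is applied to \<open>i\<close>, \<open>j\<close>, \<open>r\<close> in
        whatever order they occur.\<close>
      consider "j \<le> r" | "i \<le> r" "r < j" | "r < i" "r < j" using ij by linarith
      thus ?thesis
      proof cases
        case 1
        have "t i r = t i j \<otimes> t j r" using 1 ij r by (simp add: t_mult)
        thus ?thesis using 1 ij r t_closed[of i j] t_closed[of j r]
          by (simp add: lower m_assoc)
      next
        case 2
        thus ?thesis using ij r t_closed[of r j] by (simp add: lower upper t_mult)
      next
        case 3
        have "t r j = t r i \<otimes> t i j" using 3 ij r by (simp add: t_mult)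
        thus ?thesis using 3 ij r t_closed[of r i] t_closed[of i j]
          by (simp add: upper m_assoc[symmetric])
      qed
    qed
    finally show ?thesis .
  qed
  thus ?thesis using that hom by (simp add: r_def)
qed

end

section \<open>The isomorphism\<close>

lemma finsum_UT_entry:
  fixes f :: "'k \<Rightarrow> 'a :: field mat"
  assumes "finite S" "f \<in> S \<rightarrow> carrier (UT TYPE('a) m)" "i < m" "j < m"
  shows "finsum (UT TYPE('a) m) f S $$ (i, j) = (\<Sum>k\<in>S. f k $$ (i, j))"
  using assms(1,2)
proof (induction S rule: finite_induct)
  case empty
  interpret UT: abelian_group "UT TYPE('a) m"
    using vectorspace_UT[of m, where 'a='a] by (simp add: vectorspace_def Module.module_def)
  show ?case using assms by simp
next
  case (insert k S)
  interpret UT: abelian_group "UT TYPE('a) m"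
    using vectorspace_UT[of m, where 'a='a] by (simp add: vectorspace_def Module.module_def)
  have "finsum (UT TYPE('a) m) f S \<in> carrier (UT TYPE('a) m)"
    using insert.prems by (intro UT.finsum_closed) auto
  hence "dim_row (finsum (UT TYPE('a) m) f S) = m" "dim_col (finsum (UT TYPE('a) m) f S) = m"
    by (rule carrier_UT_dim)+
  thus ?case using insert assms(3,4) by simp
qed

lemma in_span_matrix_units:
  fixes X :: "'a :: field mat"
  assumes X: "X \<in> carrier (UT TYPE('a) m)"
    and supp: "\<And>i j. i \<le> j \<Longrightarrow> j < m \<Longrightarrow> X $$ (i, j) \<noteq> 0 \<Longrightarrow> P i j"
  shows "X \<in> LinearCombinations.module.span class_ring (UT TYPE('a) m)
    {matrix_unit m i j | i j. i \<le> j \<and> j < m \<and> P i j}"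
proof -
  interpret V: vectorspace class_ring "UT TYPE('a) m" by (rule vectorspace_UT)
  let ?E = "{matrix_unit m i j :: 'a mat | i j. i \<le> j \<and> j < m \<and> P i j}"
  have E: "?E \<subseteq> carrier (UT TYPE('a) m)" using matrix_unit_closed by blast
  interpret sub: submodule class_ring "V.span ?E" "UT TYPE('a) m"
    by (rule V.span_is_submodule[OF E])
  \<comment> \<open>\<open>Q\<close> is a finite set of positions containing the support; each step
    clears one of them.\<close>
  have "X \<in> V.span ?E" if "finite Q" "X \<in> carrier (UT TYPE('a) m)"
    "\<And>i j. i \<le> j \<Longrightarrow> j < m \<Longrightarrow> X $$ (i, j) \<noteq> 0 \<Longrightarrow> P i j \<and> (i, j) \<in> Q" for Q X
    using that
  proof (induction Q arbitrary: X rule: finite_induct)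
    case empty
    have "X = 0\<^sub>m m m"
      by (rule UT_eqI[OF empty(1) UT_consts(1)]) (use empty(2) in auto)
    thus ?case using sub.zero_closed by simp
  next
    case (insert p Q)
    obtain i j where p: "p = (i, j)" by (cases p)
    show ?case
    proof (cases "i \<le> j \<and> j < m \<and> X $$ (i, j) \<noteq> 0")
      case False
      thus ?thesis using insert.prems p by (intro insert.IH) auto
    next
      case True
      hence ij: "i \<le> j" "j < m" "P i j" using insert.prems(2) by auto
      have Eij: "matrix_unit m i j \<in> carrier (UT TYPE('a) m)" using ij matrix_unit_closed by blast
      let ?Y = "X - X $$ (i, j) \<cdot>\<^sub>m matrix_unit m i j"
      have "?Y \<in> V.span ?E"
      proof (rule insert.IH)
        fix k l assume kl: "k \<le> l" "l < m" "?Y $$ (k, l) \<noteq> 0"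
        hence "(k, l) \<noteq> (i, j)" "X $$ (k, l) \<noteq> 0"
          using ij Eij carrier_UT_dim[OF Eij] by (auto split: if_splits)
        thus "P k l \<and> (k, l) \<in> Q" using insert.prems(2)[OF kl(1,2)] p by auto
      qed (use insert.prems Eij in simp)
      moreover have "matrix_unit m i j \<in> V.span ?E"
        using V.in_own_span[OF E] ij by blast
      hence "X $$ (i, j) \<cdot>\<^sub>m matrix_unit m i j \<in> V.span ?E"
        using sub.smult_closed by (simp add: class_ring_simps)
      ultimately have "?Y + X $$ (i, j) \<cdot>\<^sub>m matrix_unit m i j \<in> V.span ?E"
        using sub.m_closed by simp
      moreover have "?Y + X $$ (i, j) \<cdot>\<^sub>m matrix_unit m i j = X"
        using carrier_UT_dim[OF Eij] carrier_UT_dim[OF insert.prems(1)] by (intro eq_matI) auto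
      ultimately show ?thesis by simp
    qed
  qed
  from this[of "{..<m} \<times> {..<m}" X] show ?thesis using X supp by auto
qed

text \<open>Sorting the entries of \<open>X\<close> by their finest degree writes \<open>X\<close>
  as the finite sum that \<open>induced_grading\<close> asks for.\<close>

lemma in_induced_finest_grading:
  fixes X :: "'a :: field mat"
  assumes X: "X \<in> carrier (UT TYPE('a) m)"
    and supp: "\<And>i j. i \<le> j \<Longrightarrow> j < m \<Longrightarrow> X $$ (i, j) \<noteq> 0 \<Longrightarrow> \<alpha> (finest_degree m i j) = g"
  shows "X \<in> induced_grading (Z_pow (m div 2)) (UT TYPE('a) m) \<alpha> (finest_grading TYPE('a) m) g"
proof -
  \<comment> \<open>Positions below the diagonal contribute degrees too; \<open>X\<close> vanishes
    there, so they add nothing to the sum.\<close>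
  define S where "S = {k \<in> (\<lambda>(i, j). finest_degree m i j) ` ({..<m} \<times> {..<m}). \<alpha> k = g}"
  define f where "f k = mat m m (\<lambda>(i, j). if finest_degree m i j = k then X $$ (i, j) else 0)" for k
  have S: "finite S" "S \<subseteq> {k \<in> carrier (Z_pow (m div 2)). \<alpha> k = g}"
    using finest_degree_closed by (auto simp: S_def)
  have fC: "f k \<in> carrier (UT TYPE('a) m)" for k
    using X by (auto simp: f_def carrier_UT_iff)
  have "f k \<in> finest_grading TYPE('a) m k" for k
    unfolding finest_grading_def elementary_grading_def finest_degree_def[symmetric]
    by (rule in_span_matrix_units[OF fC]) (auto simp: f_def split: if_splits)
  moreover have "X = finsum (UT TYPE('a) m) f S"
  proof (rule UT_eqI[OF X])
    interpret UT: abelian_group "UT TYPE('a) m"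
      using vectorspace_UT[of m, where 'a='a] by (simp add: vectorspace_def Module.module_def)
    show "finsum (UT TYPE('a) m) f S \<in> carrier (UT TYPE('a) m)"
      using fC by (intro UT.finsum_closed) auto
    fix i j assume ij: "i \<le> j" "j < m"
    have "finsum (UT TYPE('a) m) f S $$ (i, j) = (\<Sum>k\<in>S. f k $$ (i, j))"
      using ij fC S by (intro finsum_UT_entry) auto
    also have "\<dots> = (\<Sum>k\<in>S. if k = finest_degree m i j then X $$ (i, j) else 0)"
      using ij by (intro sum.cong) (auto simp: f_def)
    also have "\<dots> = (if finest_degree m i j \<in> S then X $$ (i, j) else 0)"
      using S by simp
    also have "\<dots> = X $$ (i, j)"
      using supp[OF ij] ij by (auto simp: S_def)
    finally show "X $$ (i, j) = finsum (UT TYPE('a) m) f S $$ (i, j)" by simp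
  qed
  ultimately show ?thesis unfolding induced_grading_def using S by blast
qed

lemma conjugation_iso:
  fixes W U :: "'a :: field mat"
  assumes W: "W \<in> carrier (UT TYPE('a) m)" and U: "U \<in> carrier (UT TYPE('a) m)"
    and WU: "W * U = 1\<^sub>m m" and UW: "U * W = 1\<^sub>m m"
  shows "linear_map class_ring (UT TYPE('a) m) (UT TYPE('a) m) (\<lambda>x. W * x * U)"
    and "(\<lambda>x. W * x * U) \<in> ring_iso (UT TYPE('a) m) (UT TYPE('a) m)"
proof -
  let ?C = "carrier (UT TYPE('a) m)"
  note assoc = UT_assoc[where ty="TYPE('a)" and m=m]
  have one: "1\<^sub>m m * x = x" "x * 1\<^sub>m m = x" if "x \<in> ?C" for x
    using that by (simp_all add: carrier_UT_iff)
  have add: "W * (x + y) * U = W * x * U + W * y * U" if "x \<in> ?C" "y \<in> ?C" for x y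
    using that W U by (simp add: UT_distrib[where ty="TYPE('a)" and m=m])
  have mult: "W * (x * y) * U = (W * x * U) * (W * y * U)" if "x \<in> ?C" "y \<in> ?C" for x y
  proof -
    have "(W * x * U) * (W * y * U) = W * x * ((U * W) * y) * U"
      using W U that by (simp add: assoc)
    thus ?thesis using W U that by (simp add: UW one assoc)
  qed
  have inv1: "U * (W * x * U) * W = x" if "x \<in> ?C" for x
  proof -
    have "U * (W * x * U) * W = (U * W) * x * (U * W)" using W U that by (simp add: assoc)
    thus ?thesis using that by (simp add: UW one)
  qed
  have inv2: "W * (U * x * W) * U = x" if "x \<in> ?C" for x
  proof -
    have "W * (U * x * W) * U = (W * U) * x * (W * U)" using W U that by (simp add: assoc)
    thus ?thesis using that by (simp add: WU one)
  qed
  show "linear_map class_ring (UT TYPE('a) m) (UT TYPE('a) m) (\<lambda>x. W * x * U)"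
    using vectorspace_UT[of m, where 'a='a] W U add
    by (simp add: linear_map_def mod_hom_def mod_hom_axioms_def LinearCombinations.module_hom_def
        vectorspace_def UT_smult_mult[where ty="TYPE('a)" and m=m])
  have "bij_betw (\<lambda>x. W * x * U) ?C ?C"
    by (rule bij_betw_byWitness[where f' = "\<lambda>x. U * x * W"]) (use W U inv1 inv2 in auto)
  moreover have "(\<lambda>x. W * x * U) \<in> Ring.ring_hom (UT TYPE('a) m) (UT TYPE('a) m)"
    by (rule ring_hom_memI) (use W U add mult WU one in auto)
  ultimately show "(\<lambda>x. W * x * U) \<in> ring_iso (UT TYPE('a) m) (UT TYPE('a) m)"
    by (simp add: ring_iso_def)
qed

lemma symplectic_entry:
  fixes X :: "'a :: field mat"
  assumes "even m"
  shows "symplectic m X \<in> carrier_mat m m"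
    and "i < m \<Longrightarrow> j < m \<Longrightarrow> symplectic m X $$ (i, j) =
      (if i < m div 2 then 1 else -1) * (if j < m div 2 then 1 else -1) * X $$ (m - 1 - j, m - 1 - i)"
proof -
  define \<epsilon> :: "nat \<Rightarrow> 'a" where "\<epsilon> i = (if i < m div 2 then 1 else -1)" for i
  define D where "D = mat m m (\<lambda>(i, j). if i = j then \<epsilon> i else 0)"
  have D: "D \<in> carrier (UT TYPE('a) m)" unfolding D_def by (rule diag_closed)
  have block: "diag_block_mat [1\<^sub>m (m div 2), - 1\<^sub>m (m div 2)] = D"
    using assms by (intro eq_matI) (auto simp: D_def \<epsilon>_def Let_def elim!: evenE)
  have DD: "D * D = 1\<^sub>m m"
    using diag_mult_left[OF D, of _ _ \<epsilon>, folded D_def]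
    by (intro UT_eqI[OF UT_closed(5)[OF D D] UT_consts(2)])
       (auto simp: D_def \<epsilon>_def simp del: index_mult_mat(1))
  \<comment> \<open>The inverse is taken in the monoid \<open>UT\<close>; it is \<open>D\<close>
    because \<open>D\<close> squares to the identity.\<close>
  have inv: "inv\<^bsub>UT TYPE('a) m\<^esub> D = D"
    unfolding m_inv_def
  proof (rule the_equality)
    fix Y assume Y: "Y \<in> carrier (UT TYPE('a) m) \<and> D \<otimes>\<^bsub>UT TYPE('a) m\<^esub> Y = \<one>\<^bsub>UT TYPE('a) m\<^esub> \<and>
      Y \<otimes>\<^bsub>UT TYPE('a) m\<^esub> D = \<one>\<^bsub>UT TYPE('a) m\<^esub>"
    hence "Y = (D * D) * Y" by (simp add: DD carrier_UT_iff)
    also have "\<dots> = D * (D * Y)" using UT_assoc D Y by blast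
    also have "\<dots> = D" using Y D by (simp add: carrier_UT_iff)
    finally show "Y = D" .
  qed (use D DD in simp)
  have sym: "symplectic m X = D * reflection m X * D"
    unfolding symplectic_def Let_def block inv ..
  have R: "reflection m X \<in> carrier_mat m m" by (simp add: reflection_def)
  show "symplectic m X \<in> carrier_mat m m" unfolding sym using D R by (auto simp: carrier_UT_iff)
  assume ij: "i < m" "j < m"
  \<comment> \<open>\<open>X\<close> is arbitrary, so its reflection need not be triangular and the
    products with \<open>D\<close> are computed for all square matrices of size
    \<open>m\<close>.\<close>
  have DR: "(D * Y) $$ (a, b) = \<epsilon> a * Y $$ (a, b)" "(Y * D) $$ (a, b) = Y $$ (a, b) * \<epsilon> b"
    if "Y \<in> carrier_mat m m" "a < m" "b < m" for Y a b
  proof -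
    have "(D * Y) $$ (a, b) = (\<Sum>k<m. D $$ (a, k) * Y $$ (k, b))"
      using that by (simp add: D_def scalar_prod_def lessThan_atLeast0)
    also have "\<dots> = (\<Sum>k<m. if k = a then \<epsilon> a * Y $$ (a, b) else 0)"
      using that by (intro sum.cong) (auto simp: D_def)
    finally show "(D * Y) $$ (a, b) = \<epsilon> a * Y $$ (a, b)" using that by simp
    have "(Y * D) $$ (a, b) = (\<Sum>k<m. Y $$ (a, k) * D $$ (k, b))"
      using that by (simp add: D_def scalar_prod_def lessThan_atLeast0)
    also have "\<dots> = (\<Sum>k<m. if k = b then Y $$ (a, b) * \<epsilon> b else 0)"
      using that by (intro sum.cong) (auto simp: D_def)
    finally show "(Y * D) $$ (a, b) = Y $$ (a, b) * \<epsilon> b" using that by simp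
  qed
  have "D * reflection m X \<in> carrier_mat m m" using D R by (auto simp: carrier_UT_iff)
  hence "symplectic m X $$ (i, j) = \<epsilon> i * reflection m X $$ (i, j) * \<epsilon> j"
    unfolding sym using ij DR R by simp
  thus "symplectic m X $$ (i, j) =
      (if i < m div 2 then 1 else -1) * (if j < m div 2 then 1 else -1) * X $$ (m - 1 - j, m - 1 - i)"
    using ij by (simp add: \<epsilon>_def reflection_def)
qed

section \<open>Diagonal rescaling and the sign of the involution\<close>

context graded_UT_basis
begin

text \<open>Diagonal conjugation multiplies each coordinate by a nonzero scalar, so it respects the
  grading. Hypothesis \<open>ve\<close> is the compatibility of the two involutions on one
  coordinate, with denominators cleared; the signs \<open>e\<close> cover both standard involutions
  at once.\<close>

lemma isomorphic_by_rescaling: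
  assumes v: "\<And>i. i < m \<Longrightarrow> v i \<noteq> 0"
    and \<tau>: "\<And>X. \<tau> X \<in> carrier_mat m m"
      "\<And>X i j. i < m \<Longrightarrow> j < m \<Longrightarrow> \<tau> X $$ (i, j) = e i * e j * X $$ (m - 1 - j, m - 1 - i)"
    and ve: "\<And>i j. i \<le> j \<Longrightarrow> j < m \<Longrightarrow>
      v (m - 1 - j) * c i j * v j = e (m - 1 - j) * e (m - 1 - i) * v i * v (m - 1 - i)"
    and \<alpha>: "\<And>i j. i \<le> j \<Longrightarrow> j < m \<Longrightarrow> \<alpha> (finest_degree m i j) = t i j"
  shows "graded_inv_isomorphic G (UT TYPE('a) m) A s (UT TYPE('a) m)
    (induced_grading (Z_pow (m div 2)) (UT TYPE('a) m) \<alpha> (finest_grading TYPE('a) m)) \<tau>"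
proof -
  define V where "V = mat m m (\<lambda>(i, j). if i = j then v i else 0)"
  define V' where "V' = mat m m (\<lambda>(i, j). if i = j then inverse (v i) else 0)"
  have V: "V \<in> C" "V' \<in> C" unfolding V_def V'_def by (rule diag_closed)+
  have VV': "V * V' = 1\<^sub>m m" "V' * V = 1\<^sub>m m"
  proof -
    show "V * V' = 1\<^sub>m m"
    proof (rule UT_eqI[OF UT_closed(5)[OF V] UT_consts(2)])
      fix i j assume "i \<le> j" "j < m"
      thus "(V * V') $$ (i, j) = 1\<^sub>m m $$ (i, j)"
        using diag_mult_left[OF V(2), of i j v, folded V_def] v by (simp add: V'_def del: index_mult_mat(1))
    qed
    thus "V' * V = 1\<^sub>m m"
      using mat_mult_left_right_inverse[of V m V'] V by (simp add: carrier_UT_iff)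
  qed
  define \<phi> where "\<phi> = (\<lambda>x. (V * W) * x * (U * V'))"
  have VW: "V * W \<in> C" "U * V' \<in> C" using V U W by auto
  have "(V * W) * (U * V') = V * ((W * U) * V')"
    using V U W by (simp add: UT_assoc[where ty="TYPE('a)" and m=m])
  hence 1: "(V * W) * (U * V') = 1\<^sub>m m" using V by (simp add: WU VV' C_one)
  have "(U * V') * (V * W) = U * ((V' * V) * W)"
    using V U W by (simp add: UT_assoc[where ty="TYPE('a)" and m=m])
  hence 2: "(U * V') * (V * W) = 1\<^sub>m m" using W by (simp add: UW VV' C_one)
  note iso = conjugation_iso[OF VW 1 2, folded \<phi>_def]
  have \<phi>C: "\<phi> x \<in> C" if "x \<in> C" for x using that VW by (simp add: \<phi>_def)
  have entry: "\<phi> x $$ (i, j) = v i * coord x $$ (i, j) * inverse (v j)"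
    if "x \<in> C" "i < m" "j < m" for x i j
  proof -
    have "\<phi> x = V * coord x * V'"
      unfolding \<phi>_def using V U W that(1) by (simp add: UT_assoc[where ty="TYPE('a)" and m=m])
    moreover have "(V * coord x) \<in> C" using V coord_C[OF that(1)] by simp
    ultimately show ?thesis
      using diag_mult_right[of "V * coord x" "TYPE('a)" m i j "\<lambda>i. inverse (v i)", folded V'_def]
        diag_mult_left[OF coord_C[OF that(1)], of i j v, folded V_def] that by simp
  qed
  have grade: "\<phi> x \<in> induced_grading (Z_pow (m div 2)) (UT TYPE('a) m) \<alpha> (finest_grading TYPE('a) m) g"
    if g: "g \<in> carrier G" and x: "x \<in> A g" for g x
  proof (rule in_induced_finest_grading)
    have xC: "x \<in> C" using A_C g x .
    thus "\<phi> x \<in> C" by (rule \<phi>C)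
    fix i j assume ij: "i \<le> j" "j < m" "\<phi> x $$ (i, j) \<noteq> 0"
    hence "coord x $$ (i, j) \<noteq> 0" using entry[OF xC, of i j] by auto
    thus "\<alpha> (finest_degree m i j) = g" using coord_support[OF g x ij(1,2)] \<alpha> ij by simp
  qed
  have inv: "\<phi> (s x) = \<tau> (\<phi> x)" if x: "x \<in> C" for x
  proof (rule eq_matI)
    have "\<phi> (s x) \<in> C" using \<phi>C s_closed x by blast
    note dims = C_dim[OF this]
    show "dim_row (\<phi> (s x)) = dim_row (\<tau> (\<phi> x))" "dim_col (\<phi> (s x)) = dim_col (\<tau> (\<phi> x))"
      using dims \<tau>(1)[of "\<phi> x"] by auto
    fix k l assume "k < dim_row (\<tau> (\<phi> x))" "l < dim_col (\<tau> (\<phi> x))"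
    hence kl: "k < m" "l < m" using \<tau>(1)[of "\<phi> x"] by auto
    show "\<phi> (s x) $$ (k, l) = \<tau> (\<phi> x) $$ (k, l)"
    proof (cases "k \<le> l")
      \<comment> \<open>The reflection maps positions below the diagonal to such positions, so both
        sides vanish.\<close>
      case False
      have "\<phi> (s x) $$ (k, l) = 0" using carrier_UT_lower[OF \<open>\<phi> (s x) \<in> C\<close>] False kl by simp
      moreover have "\<phi> x $$ (m - 1 - l, m - 1 - k) = 0"
        using carrier_UT_lower[OF \<phi>C[OF x], of "m - 1 - k" "m - 1 - l"] False kl by simp
      ultimately show ?thesis using \<tau>(2)[OF kl] by simp
    next
      case True
      define i j where "i = m - 1 - l" and "j = m - 1 - k"
      have ij: "i \<le> j" "j < m" "i < m" "k = m - 1 - j" "l = m - 1 - i"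
        using True kl by (auto simp: i_def j_def)
      have "\<phi> (s x) $$ (k, l) = v k * (c i j * coord x $$ (i, j)) * inverse (v l)"
        using entry[OF s_closed[OF x] kl] coord_s[OF x ij(1,2)] ij(4,5) by simp
      also have "\<dots> = e k * e l * (v i * coord x $$ (i, j) * inverse (v j))"
      proof -
        have "v k * c i j * v j = e k * e l * v i * v l" using ve[OF ij(1,2)] ij(4,5) by simp
        hence "v k * c i j = e k * e l * v i * v l * inverse (v j)"
          using v[OF ij(2)] by (simp add: field_simps)
        have "v k * (c i j * coord x $$ (i, j)) * inverse (v l)
            = (v k * c i j) * coord x $$ (i, j) * inverse (v l)" by (simp only: mult_ac)
        also have "\<dots> = (e k * e l * (v i * coord x $$ (i, j) * inverse (v j))) * (v l * inverse (v l))"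
          unfolding \<open>v k * c i j = e k * e l * v i * v l * inverse (v j)\<close> by (simp only: mult_ac)
        finally show ?thesis using v[OF kl(2)] by simp
      qed
      also have "\<dots> = e k * e l * \<phi> x $$ (i, j)" using entry[OF x ij(3,2)] by simp
      finally show ?thesis using \<tau>(2)[OF kl] by (simp add: i_def j_def)
    qed
  qed
  show ?thesis
    unfolding graded_inv_isomorphic_def
    using iso grade inv by blast
qed

text \<open>Since \<open>c i j = c 0 j / c 0 i\<close>, a rescaling exists once the function \<open>c 0\<close> is symmetric up to
  the signs \<open>e\<close>.  Its value at the middle index of odd \<open>m\<close> is normalised to \<open>1\<close>, so that no square
  roots are needed.\<close>

lemma rescaling:
  assumes m: "0 < m" and e: "\<And>i. i < m \<Longrightarrow> e i * e i = (1 :: 'a)"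
    and sym: "\<And>i. i < m \<Longrightarrow> e i * c 0 (m - 1 - i) = e (m - 1 - i) * c 0 i"
  obtains v where "\<And>i. i < m \<Longrightarrow> v i \<noteq> 0"
    "\<And>i j. i \<le> j \<Longrightarrow> j < m \<Longrightarrow>
      v (m - 1 - j) * c i j * v j = e (m - 1 - j) * e (m - 1 - i) * v i * v (m - 1 - i)"
proof -
  \<comment> \<open>The equation wanted for \<open>v\<close> says that
    \<open>v i * v (m - 1 - i) * p i\<close> is independent of \<open>i\<close>, and
    \<open>sym\<close> says that \<open>p\<close> is invariant under reflection.\<close>
  define p where "p i = e (m - 1 - i) * c 0 i" for i
  \<comment> \<open>Only the first index of each reflected pair is rescaled, to reach the common
    value \<open>p (m div 2)\<close>.\<close>
  define v where "v i = (if i < m - 1 - i then p (m div 2) / p i else 1)" for i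
  have e0: "e i \<noteq> 0" if "i < m" for i using e[OF that] by auto
  have p0: "p i \<noteq> 0" if "i < m" for i
    using e0[of "m - 1 - i"] c_nonzero[of 0 i] that by (simp add: p_def)
  have psym: "p (m - 1 - i) = p i" if "i < m" for i
    using sym[OF that] that by (simp add: p_def)
  have half: "m div 2 < m" using m by simp
  have vp: "v i * v (m - 1 - i) * p i = p (m div 2)" if i: "i < m" for i
  proof (cases i "m - 1 - i" rule: linorder_cases)
    case less
    hence "v i = p (m div 2) / p i" "v (m - 1 - i) = 1" using i by (auto simp: v_def)
    thus ?thesis using p0[OF i] by simp
  next
    case equal
    hence "i = m div 2" using i by linarith
    thus ?thesis using equal by (simp add: v_def)
  next
    case greater
    hence "v i = 1" "v (m - 1 - i) = p (m div 2) / p i" using i psym[OF i] by (auto simp: v_def)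
    thus ?thesis using p0[OF i] by simp
  qed
  show ?thesis
  proof (rule that)
    show "v i \<noteq> 0" if "i < m" for i using p0[OF that] p0[OF half] by (simp add: v_def)
    fix i j assume ij: "i \<le> j" "j < m"
    let ?i = "m - 1 - i" and ?j = "m - 1 - j"
    have r: "i < m" "?j < m" "?i < m" using ij by auto
    have c: "c 0 i * c i j = c 0 j" using c_mult[of 0 i j] ij by simp
    have eq: "v j * v ?j * (e ?j * c 0 j) = v i * v ?i * (e ?i * c 0 i)"
      using vp[OF ij(2)] vp[OF r(1)] by (simp add: p_def)
    have "c 0 i * (v ?j * c i j * v j) = v j * v ?j * (e ?j * c 0 j) * e ?j"
    proof -
      have "v j * v ?j * (e ?j * c 0 j) * e ?j = (e ?j * e ?j) * (v j * v ?j * c 0 j)"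
        by (simp only: mult_ac)
      also have "\<dots> = v j * v ?j * (c 0 i * c i j)" using e[OF r(2)] c by simp
      finally show ?thesis by (simp only: mult_ac)
    qed
    also have "\<dots> = c 0 i * (e ?j * e ?i * v i * v ?i)" unfolding eq by (simp add: mult_ac)
    finally show "v ?j * c i j * v j = e ?j * e ?i * v i * v ?i"
      using c_nonzero[of 0 i] r by simp
  qed
qed

text \<open>The corner position \<open>(0, m - 1)\<close> is its own reflection, so \<open>s\<close>
  acts on its basis element by a scalar \<open>l\<close> with square \<open>1\<close>, and
  multiplicativity spreads \<open>l\<close> to every \<open>c 0 i\<close>. For odd \<open>m\<close>
  the middle index is fixed, which rules out \<open>l = -1\<close>.\<close>

lemma c_sign:
  assumes m: "0 < m"
  shows "(\<forall>i<m. c 0 (m - 1 - i) = c 0 i) \<or> even m \<and> (\<forall>i<m. c 0 (m - 1 - i) = - c 0 i)"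
proof -
  define l where "l = c 0 (m - 1)"
  have sym: "c 0 (m - 1 - i) = l * c 0 i" if i: "i < m" for i
  proof -
    have "c 0 (m - 1 - i) * c (m - 1 - i) (m - 1) = l"
      using c_mult[of 0 "m - 1 - i" "m - 1"] i by (simp add: l_def)
    moreover have "c 0 i * c (m - 1 - i) (m - 1) = 1" using c_reflect[of 0 i] i by simp
    ultimately show ?thesis
      by (metis mult.commute mult.left_commute mult.right_neutral)
  qed
  have "l * l = 1" using sym[of "m - 1"] c_diag[OF m] m by (simp add: l_def)
  hence "l = 1 \<or> l = -1" by (simp add: square_eq_1_iff)
  thus ?thesis
  proof
    assume l: "l = -1"
    have "even m"
    proof (rule ccontr)
      assume "odd m"
      then obtain k where k: "m = 2 * k + 1" by (rule oddE)
      hence "c 0 k = - c 0 k" using sym[of k] l by simp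
      thus False using c_nonzero[of 0 k] k by simp
    qed
    thus ?thesis using sym l by simp
  qed (use sym in simp)
qed

theorem isomorphic_finest:
  assumes m: "0 < m"
  shows "\<exists>\<alpha> \<in> hom (Z_pow (m div 2)) G.
    (let A' = induced_grading (Z_pow (m div 2)) (UT TYPE('a) m) \<alpha> (finest_grading TYPE('a) m) in
      graded_inv_isomorphic G (UT TYPE('a) m) A s (UT TYPE('a) m) A' (reflection m) \<or>
      (even m \<and> graded_inv_isomorphic G (UT TYPE('a) m) A s (UT TYPE('a) m) A' (symplectic m)))"
proof -
  obtain \<alpha> where \<alpha>: "\<alpha> \<in> hom (Z_pow (m div 2)) G"
    "\<And>i j. i \<le> j \<Longrightarrow> j < m \<Longrightarrow> \<alpha> (finest_degree m i j) = t i j"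
    using degree_hom[OF m] by blast
  let ?A = "induced_grading (Z_pow (m div 2)) (UT TYPE('a) m) \<alpha> (finest_grading TYPE('a) m)"
  from c_sign[OF m]
  have "graded_inv_isomorphic G (UT TYPE('a) m) A s (UT TYPE('a) m) ?A (reflection m) \<or>
      (even m \<and> graded_inv_isomorphic G (UT TYPE('a) m) A s (UT TYPE('a) m) ?A (symplectic m))"
  proof
    assume "\<forall>i<m. c 0 (m - 1 - i) = c 0 i"
    then obtain v where v: "\<And>i. i < m \<Longrightarrow> v i \<noteq> 0"
      "\<And>i j. i \<le> j \<Longrightarrow> j < m \<Longrightarrow> v (m - 1 - j) * c i j * v j = 1 * 1 * v i * v (m - 1 - i)"
      using rescaling[OF m, of "\<lambda>_. 1"] by auto
    have "graded_inv_isomorphic G (UT TYPE('a) m) A s (UT TYPE('a) m) ?A (reflection m)"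
      by (rule isomorphic_by_rescaling[where v = v and e = "\<lambda>_. 1"])
         (use v \<alpha> in \<open>auto simp: reflection_def\<close>)
    thus ?thesis ..
  next
    assume sym: "even m \<and> (\<forall>i<m. c 0 (m - 1 - i) = - c 0 i)"
    \<comment> \<open>These are the diagonal signs in the symplectic involution; they flip under the
      reflection and absorb the minus sign in the symmetry of \<open>c 0\<close>.\<close>
    define e :: "nat \<Rightarrow> 'a" where "e i = (if i < m div 2 then 1 else -1)" for i
    have "e (m - 1 - i) = - e i" if "i < m" for i
      using sym that by (auto simp: e_def elim!: evenE)
    hence "e i * c 0 (m - 1 - i) = e (m - 1 - i) * c 0 i" if "i < m" for i
      using sym that by simp
    moreover have "e i * e i = 1" for i by (simp add: e_def)
    ultimately obtain v where v: "\<And>i. i < m \<Longrightarrow> v i \<noteq> 0"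
      "\<And>i j. i \<le> j \<Longrightarrow> j < m \<Longrightarrow>
        v (m - 1 - j) * c i j * v j = e (m - 1 - j) * e (m - 1 - i) * v i * v (m - 1 - i)"
      using rescaling[OF m, of e] by blast
    have "graded_inv_isomorphic G (UT TYPE('a) m) A s (UT TYPE('a) m) ?A (symplectic m)"
    proof (rule isomorphic_by_rescaling[where v = v and e = e])
      show "symplectic m X $$ (i, j) = e i * e j * X $$ (m - 1 - j, m - 1 - i)"
        if "i < m" "j < m" for X :: "'a mat" and i j
        unfolding e_def using sym that by (intro symplectic_entry(2)) auto
    qed (use sym symplectic_entry(1) v \<alpha> in auto)
    thus ?thesis using sym by blast
  qed
  thus ?thesis using \<alpha>(1) unfolding Let_def by blast
qed

end

theorem proposition2p3:
  fixes G :: "('g, 'c) monoid_scheme"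
    and m :: nat
    and A :: "'g \<Rightarrow> 'a :: field_char_0 mat set"
    and inv_map :: "'a mat \<Rightarrow> 'a mat"
  assumes "group G"
    and "m > 0"
    and "is_grading G (UT TYPE('a) m) A"
    and "is_graded_involution G (UT TYPE('a) m) A inv_map"
  shows "\<exists>\<alpha> \<in> hom (Z_pow (m div 2)) G.
    (let A' = induced_grading (Z_pow (m div 2)) (UT TYPE('a) m) \<alpha> (finest_grading TYPE('a) m) in
      graded_inv_isomorphic G (UT TYPE('a) m) A inv_map (UT TYPE('a) m) A' (reflection m) \<or>
      (even m \<and>
       graded_inv_isomorphic G (UT TYPE('a) m) A inv_map (UT TYPE('a) m) A' (symplectic m)))"
proof -
  interpret graded_UT G m A inv_map
    using assms by (simp add: graded_UT_def graded_UT_axioms_def)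
  obtain U W t c where "graded_UT_basis G m A inv_map U W t c"
    using homogeneous_matrix_units graded_UT_axioms
    unfolding graded_UT_basis_def graded_UT_basis_axioms_def by metis
  thus ?thesis using graded_UT_basis.isomorphic_finest assms(2) by blast
qed

end
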